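(* Suppose that both of the following hold: (a) every $3$-row graph $R$ such that $R_C$ is eulerian admits an amiable coloring; (b) every cyclically $4$-edge connected cubic graph has a Kotzig-frame. Then every $2$-connected cubic graph has a cycle double cover.
   Context: All graphs are finite and loopless; parallel edges are allowed. A cycle is a connected $2$-regular graph (two parallel edges form a cycle). A graph (not necessarily connected) is eulerian if every vertex has even degree. $E_v$ is the set of edges incident with $v$; given an edge-coloring, $d_c(v,R)$ is the number of edges of color $c$ of $R$ incident with $v$. Colorings need not be proper; $3$-colorings use the colors $1,2,3$. A cycle double cover of $G$ is a set $S$ of cycles of $G$ such that every edge of $G$ lies in precisely two cycles of $S$. A Kotzig graph is a cubic graph admitting a proper $3$-edge-coloring in which each cycle whose edges carry at most two colors is hamiltonian. A subdivision of a graph $K$ is obtained from $K$ by replacing at least one edge $e=vw$ by a $vw$-path of length at least $2$. A Kotzig-frame of a $2$-connected cubic graph $G$ is a spanning subgraph $F$ of $G$ such that every component of $F$ has an even number of vertices and is either a cycle or a subdivision of a Kotzig graph. A $3$-row graph $R$ is a graph with vertices $v_{ij}$, $1\le i\le 3$, $1\le j\le s$, such that each column $C_j:=\{v_{1j},v_{2j},v_{3j}\}$ is an independent set of $R$. $R_C$ is the graph with vertex set $\{c_1,\dots,c_s\}$ obtained from $R$ by identifying, for each $j$, all vertices of $C_j$ to the single vertex $c_j$ (parallel edges are kept). An amiable coloring of a $3$-row graph $R$ is a $3$-vertex-coloring $f$ together with a $3$-edge-coloring $g$ such that for all $i\in\{1,2,3\}$ and $j\in\{1,\dots,s\}$: (i)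 $f(v)\ne f(w)$ for all $v\neq w$ in $C_j$; (ii) $f(v)\neq g(e)$ for every $v\in V(R)$ and every $e\in E_v$; (iii) $d_i(v_{1j},R)+d_i(v_{2j},R)+d_i(v_{3j},R)$ is even. *)

theory Defs
  imports Main
begin

text \<open>
  Finite loopless undirected graphs with parallel edges. An edge is an abstract object whose two
  ends are given by the function \<open>ends\<close>, of which only the values on the edge set matter.
\<close>

record ('v, 'e) mgraph =
  verts :: "'v set"
  edges :: "'e set"
  ends :: "'e \<Rightarrow> 'v set"

definition multigraph :: "('v, 'e) mgraph \<Rightarrow> bool" where
  "multigraph G \<longleftrightarrow> finite (verts G) \<and> finite (edges G) \<and>
     (\<forall>e\<in>edges G. ends G e \<subseteq> verts G \<and> card (ends G e) = 2)"

definition incident_edges :: "('v, 'e) mgraph \<Rightarrow> 'v \<Rightarrow> 'e set" where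
  "incident_edges G v = {e \<in> edges G. v \<in> ends G e}"

definition degree :: "('v, 'e) mgraph \<Rightarrow> 'v \<Rightarrow> nat" where
  "degree G v = card (incident_edges G v)"

definition regular :: "nat \<Rightarrow> ('v, 'e) mgraph \<Rightarrow> bool" where
  "regular k G \<longleftrightarrow> (\<forall>v\<in>verts G. degree G v = k)"

abbreviation cubic :: "('v, 'e) mgraph \<Rightarrow> bool" where
  "cubic G \<equiv> regular 3 G"

definition eulerian :: "('v, 'e) mgraph \<Rightarrow> bool" where
  "eulerian G \<longleftrightarrow> (\<forall>v\<in>verts G. even (degree G v))"

text \<open>
  A subgraph carries the same \<open>ends\<close> function as the whole graph, also outside its own edge set, so
  that it is determined by its vertices and edges. Hence a set of subgraphs cannot contain two
  copies of one and the same subgraph.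
\<close>

definition subgraph :: "('v, 'e) mgraph \<Rightarrow> ('v, 'e) mgraph \<Rightarrow> bool" where
  "subgraph H G \<longleftrightarrow> verts H \<subseteq> verts G \<and> edges H \<subseteq> edges G \<and> ends H = ends G \<and>
     (\<forall>e\<in>edges H. ends H e \<subseteq> verts H)"

definition adjacency :: "('v, 'e) mgraph \<Rightarrow> 'v rel" where
  "adjacency G = {(u, v). \<exists>e\<in>edges G. ends G e = {u, v}}"

definition connected_graph :: "('v, 'e) mgraph \<Rightarrow> bool" where
  "connected_graph G \<longleftrightarrow> verts G \<noteq> {} \<and>
     (\<forall>u\<in>verts G. \<forall>v\<in>verts G. (u, v) \<in> (adjacency G)\<^sup>*)"

definition component :: "('v, 'e) mgraph \<Rightarrow> ('v, 'e) mgraph \<Rightarrow> bool" where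
  "component G C \<longleftrightarrow> subgraph C G \<and> connected_graph C \<and>
     (\<forall>D. subgraph D G \<and> connected_graph D \<and> subgraph C D \<longrightarrow> D = C)"

definition delete_vertex :: "('v, 'e) mgraph \<Rightarrow> 'v \<Rightarrow> ('v, 'e) mgraph" where
  "delete_vertex G v =
     \<lparr>verts = verts G - {v}, edges = edges G - incident_edges G v, ends = ends G\<rparr>"

definition delete_edges :: "('v, 'e) mgraph \<Rightarrow> 'e set \<Rightarrow> ('v, 'e) mgraph" where
  "delete_edges G A = \<lparr>verts = verts G, edges = edges G - A, ends = ends G\<rparr>"

text \<open>
  Two vertices suffice here: the cubic graph with two vertices and three parallel edges counts as
  2-connected.
\<close>

definition two_connected :: "('v, 'e) mgraph \<Rightarrow> bool" where
  "two_connected G \<longleftrightarrow> connected_graph G \<and> card (verts G) \<ge> 2 \<and>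
     (\<forall>v\<in>verts G. connected_graph (delete_vertex G v))"

definition is_cycle :: "('v, 'e) mgraph \<Rightarrow> bool" where
  "is_cycle C \<longleftrightarrow> multigraph C \<and> connected_graph C \<and> regular 2 C"

definition cycle_of :: "('v, 'e) mgraph \<Rightarrow> ('v, 'e) mgraph \<Rightarrow> bool" where
  "cycle_of G C \<longleftrightarrow> subgraph C G \<and> is_cycle C"

definition cycle_double_cover :: "('v, 'e) mgraph \<Rightarrow> ('v, 'e) mgraph set \<Rightarrow> bool" where
  "cycle_double_cover G S \<longleftrightarrow> (\<forall>C\<in>S. cycle_of G C) \<and>
     (\<forall>e\<in>edges G. card {C \<in> S. e \<in> edges C} = 2)"

text \<open>
  Connected graphs without two disjoint cycles, such as \<open>K\<^sub>4\<close> and \<open>K\<^sub>3\<^sub>,\<^sub>3\<close>, are cyclically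
  \<open>k\<close>-edge connected for every \<open>k\<close>.
\<close>

definition cyclically_edge_connected :: "nat \<Rightarrow> ('v, 'e) mgraph \<Rightarrow> bool" where
  "cyclically_edge_connected k G \<longleftrightarrow> connected_graph G \<and>
     (\<forall>A\<subseteq>edges G. card A < k \<longrightarrow>
        \<not> (\<exists>C D. component (delete_edges G A) C \<and> component (delete_edges G A) D \<and> C \<noteq> D \<and>
              (\<exists>Z. cycle_of C Z) \<and> (\<exists>Z. cycle_of D Z)))"

definition edge_3_coloring :: "('v, 'e) mgraph \<Rightarrow> ('e \<Rightarrow> nat) \<Rightarrow> bool" where
  "edge_3_coloring G c \<longleftrightarrow> (\<forall>e\<in>edges G. c e \<in> {1, 2, 3})"

definition vertex_3_coloring :: "('v, 'e) mgraph \<Rightarrow> ('v \<Rightarrow> nat) \<Rightarrow> bool" where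
  "vertex_3_coloring G f \<longleftrightarrow> (\<forall>v\<in>verts G. f v \<in> {1, 2, 3})"

definition proper_edge_coloring :: "('v, 'e) mgraph \<Rightarrow> ('e \<Rightarrow> nat) \<Rightarrow> bool" where
  "proper_edge_coloring G c \<longleftrightarrow>
     (\<forall>e\<in>edges G. \<forall>e'\<in>edges G. e \<noteq> e' \<and> ends G e \<inter> ends G e' \<noteq> {} \<longrightarrow> c e \<noteq> c e')"

definition hamiltonian_cycle :: "('v, 'e) mgraph \<Rightarrow> ('v, 'e) mgraph \<Rightarrow> bool" where
  "hamiltonian_cycle G C \<longleftrightarrow> cycle_of G C \<and> verts C = verts G"

definition kotzig_graph :: "('v, 'e) mgraph \<Rightarrow> bool" where
  "kotzig_graph K \<longleftrightarrow> multigraph K \<and> cubic K \<and>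
     (\<exists>c. edge_3_coloring K c \<and> proper_edge_coloring K c \<and>
        (\<forall>C. cycle_of K C \<and> card (c ` edges C) \<le> 2 \<longrightarrow> hamiltonian_cycle K C))"

text \<open>A path is given by the list of its vertices and the list of its edges; its length is the
  length of the latter.\<close>

definition path_in :: "('v, 'e) mgraph \<Rightarrow> 'v list \<Rightarrow> 'e list \<Rightarrow> bool" where
  "path_in G vs es \<longleftrightarrow> length vs = Suc (length es) \<and> distinct vs \<and>
     set vs \<subseteq> verts G \<and> set es \<subseteq> edges G \<and>
     (\<forall>i<length es. ends G (es ! i) = {vs ! i, vs ! Suc i})"

text \<open>
  \<open>H\<close> arises from \<open>K\<close> by replacing every edge \<open>e\<close> by the path with vertices \<open>vs e\<close> and edges
  \<open>es e\<close>; a path of length one stands for an edge that is kept. At least one edge has to be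
  replaced by a longer path, so \<open>K\<close> is not a subdivision of itself.
\<close>

definition subdivision_of :: "('v, 'e) mgraph \<Rightarrow> ('w, 'f) mgraph \<Rightarrow> bool" where
  "subdivision_of H K \<longleftrightarrow> (\<exists>\<phi> vs es.
     inj_on \<phi> (verts K) \<and>
     (\<forall>e\<in>edges K. path_in H (vs e) (es e) \<and>
        {hd (vs e), last (vs e)} = \<phi> ` ends K e \<and>
        set (vs e) \<inter> \<phi> ` verts K = \<phi> ` ends K e) \<and>
     (\<forall>e\<in>edges K. \<forall>e'\<in>edges K. e \<noteq> e' \<longrightarrow>
        set (vs e) \<inter> set (vs e') \<subseteq> \<phi> ` verts K \<and> set (es e) \<inter> set (es e') = {}) \<and>
     verts H = \<phi> ` verts K \<union> (\<Union>e\<in>edges K. set (vs e)) \<and>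
     edges H = (\<Union>e\<in>edges K. set (es e)) \<and>
     (\<exists>e\<in>edges K. length (es e) \<ge> 2))"

text \<open>
  Taking \<open>K\<close> over the types of \<open>G\<close> is no restriction: up to isomorphism, the vertices of \<open>K\<close> are
  vertices of the subdivision, and an edge of \<open>K\<close> can be named after an edge of its path.
\<close>

definition kotzig_frame :: "('v, 'e) mgraph \<Rightarrow> ('v, 'e) mgraph \<Rightarrow> bool" where
  "kotzig_frame G F \<longleftrightarrow> subgraph F G \<and> verts F = verts G \<and>
     (\<forall>C. component F C \<longrightarrow> even (card (verts C)) \<and>
        (is_cycle C \<or> (\<exists>K :: ('v, 'e) mgraph. kotzig_graph K \<and> subdivision_of C K)))"

text \<open>The vertex in row \<open>i\<close> and column \<open>j\<close> is the pair \<open>(i, j)\<close>.\<close>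

definition column :: "nat \<Rightarrow> (nat \<times> nat) set" where
  "column j = {(1, j), (2, j), (3, j)}"

definition three_row_graph :: "nat \<Rightarrow> (nat \<times> nat, 'e) mgraph \<Rightarrow> bool" where
  "three_row_graph s R \<longleftrightarrow> multigraph R \<and> verts R = {1..3} \<times> {1..s} \<and>
     (\<forall>j\<in>{1..s}. \<forall>e\<in>edges R. \<not> ends R e \<subseteq> column j)"

definition identify :: "('v \<Rightarrow> 'w) \<Rightarrow> ('v, 'e) mgraph \<Rightarrow> ('w, 'e) mgraph" where
  "identify q G = \<lparr>verts = q ` verts G, edges = edges G, ends = (\<lambda>e. q ` ends G e)\<rparr>"

definition column_graph :: "(nat \<times> nat, 'e) mgraph \<Rightarrow> (nat, 'e) mgraph" where
  "column_graph R = identify snd R"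

definition color_degree :: "('v, 'e) mgraph \<Rightarrow> ('e \<Rightarrow> nat) \<Rightarrow> nat \<Rightarrow> 'v \<Rightarrow> nat" where
  "color_degree R g c v = card {e \<in> incident_edges R v. g e = c}"

definition amiable_coloring ::
    "nat \<Rightarrow> (nat \<times> nat, 'e) mgraph \<Rightarrow> (nat \<times> nat \<Rightarrow> nat) \<Rightarrow> ('e \<Rightarrow> nat) \<Rightarrow> bool" where
  "amiable_coloring s R f g \<longleftrightarrow> vertex_3_coloring R f \<and> edge_3_coloring R g \<and>
     (\<forall>j\<in>{1..s}. \<forall>v\<in>column j. \<forall>w\<in>column j. v \<noteq> w \<longrightarrow> f v \<noteq> f w) \<and>
     (\<forall>v\<in>verts R. \<forall>e\<in>incident_edges R v. f v \<noteq> g e) \<and>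
     (\<forall>i\<in>{1, 2, 3}. \<forall>j\<in>{1..s}.
        even (color_degree R g i (1, j) + color_degree R g i (2, j) + color_degree R g i (3, j)))"

end

theory Submission
  imports Defs
begin

text \<open>
  Instead of cycles, look for even edge sets: sets of edges meeting every vertex an even number of
  times. Even sets are closed under symmetric difference, which cycles are not, and in a cubic
  graph a family of even sets covering every edge exactly twice falls apart into the cycles of a
  cycle double cover (\<open>cycle_double_cover_if_even_double_cover\<close>). No cycle arises
  twice, because the third edge at a vertex of a repeated cycle could not be covered.

  Small cuts are removed by induction on the number of vertices
  (\<open>even_double_cover_if_cyclically_4_edge_connected\<close>). If both sides of a cut with three edges are
  contracted in turn, then in a double cover of either contraction every two edges of the cut lie
  together in exactly one even set. Hence the sets of the two covers that meet the cut match
  up and can be united (\<open>even_double_cover_glue\<close>). A cut with two edges becomes one with three edges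
  when an end of one of its edges changes sides, unless there are only two vertices on either side;
  that graph is covered by hand (\<open>even_double_cover_necklace\<close>).

  What remains are cyclically 4-edge connected graphs, which by hypothesis have a Kotzig-frame \<open>F\<close>.
  Color the edges of a cycle component of \<open>F\<close> all alike, and give the edges of a subdivided Kotzig
  graph the color of the edge that they come from. For each color \<open>c\<close> the frame edges of color
  different from \<open>c\<close> then form, in every component, an even connected graph (\<open>frame_coloring\<close>), and
  permuting the three colors inside a component does not change this. The components are the
  columns of a 3-row graph; an edge outside \<open>F\<close> that ends at \<open>x\<close> is attached to the row given by
  the color of the two frame edges at \<open>x\<close>. An amiable coloring chooses for every component a
  permutation of the colors, and for every edge outside \<open>F\<close> a color \<open>c\<close> that differs from the
  permuted color of the frame edges at both ends. So both ends of this edge lie on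
  the connected even graphs obtained by dropping \<open>c\<close>, and the parity condition says that each of
  these graphs receives evenly many such ends. Let \<open>M c\<close> be the edges outside \<open>F\<close> of color \<open>c\<close> and \<open>H c\<close> the
  frame edges of color different from \<open>c\<close>. By parity, \<open>M c\<close> can be completed inside \<open>H c\<close> to an even
  set \<open>M c \<union> J c\<close>, and then \<open>M c \<union> (H c - J c)\<close> is even, too. These two sets cover \<open>M c\<close> twice and
  \<open>H c\<close> once. A frame edge belongs to \<open>H c\<close> for precisely two of the three colors, so the six sets
  cover every edge exactly twice (\<open>even_double_cover_from_coloring\<close>).
\<close>

section \<open>Even edge sets\<close>

definition deg_in :: "('v, 'e) mgraph \<Rightarrow> 'e set \<Rightarrow> 'v \<Rightarrow> nat" where
  "deg_in G A v = card {e \<in> A. v \<in> ends G e}"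

definition boundary :: "('v, 'e) mgraph \<Rightarrow> 'v set \<Rightarrow> 'e set" where
  "boundary G X = {e \<in> edges G. ends G e \<inter> X \<noteq> {} \<and> ends G e - X \<noteq> {}}"

definition even_set :: "('v, 'e) mgraph \<Rightarrow> 'e set \<Rightarrow> bool" where
  "even_set G A \<longleftrightarrow> A \<subseteq> edges G \<and> (\<forall>v\<in>verts G. even (deg_in G A v))"

text \<open>
  The family is indexed, since the same even set may occur in it twice.
\<close>

definition even_double_cover :: "('v, 'e) mgraph \<Rightarrow> bool" where
  "even_double_cover G \<longleftrightarrow> (\<exists>(I :: nat set) A. finite I \<and> (\<forall>i\<in>I. even_set G (A i)) \<and>
     (\<forall>e\<in>edges G. card {i \<in> I. e \<in> A i} = 2))"

text \<open>
  Any finite index set will do, because it can be enumerated.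
\<close>

lemma even_double_coverI:
  fixes I :: "'i set"
  assumes "finite I" and "\<And>i. i \<in> I \<Longrightarrow> even_set G (A i)"
    and "\<And>e. e \<in> edges G \<Longrightarrow> card {i \<in> I. e \<in> A i} = 2"
  shows "even_double_cover G"
proof -
  obtain h where h: "bij_betw h {0..<card I} I"
    using ex_bij_betw_nat_finite[OF assms(1)] by blast
  have "card {n \<in> {0..<card I}. e \<in> A (h n)} = card {i \<in> I. e \<in> A i}" for e
  proof -
    have "h ` {n \<in> {0..<card I}. e \<in> A (h n)} = {i \<in> h ` {0..<card I}. e \<in> A i}" by auto
    also have "h ` {0..<card I} = I" using h by (rule bij_betw_imp_surj_on)
    finally have "bij_betw h {n \<in> {0..<card I}. e \<in> A (h n)} {i \<in> I. e \<in> A i}"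
      using h by (intro bij_betw_imageI) (auto simp: bij_betw_def inj_on_def)
    then show ?thesis by (rule bij_betw_same_card)
  qed
  moreover have "h n \<in> I" if "n \<in> {0..<card I}" for n using h that by (rule bij_betw_apply)
  ultimately show ?thesis
    unfolding even_double_cover_def using assms
    by (intro exI[of _ "{0..<card I}"] exI[of _ "A \<circ> h"]) auto
qed

lemma multigraphD:
  assumes "multigraph G"
  shows "finite (verts G)" "finite (edges G)" "e \<in> edges G \<Longrightarrow> ends G e \<subseteq> verts G"
    "e \<in> edges G \<Longrightarrow> card (ends G e) = 2"
  using assms by (auto simp: multigraph_def)

lemma edge_endsE:
  assumes "multigraph G" "e \<in> edges G"
  obtains u v where "ends G e = {u, v}" "u \<noteq> v" "u \<in> verts G" "v \<in> verts G"
  using multigraphD(3,4)[OF assms] card_2_iff by (metis insert_subset)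

lemma degree_eq: "degree G v = deg_in G (edges G) v"
  by (simp add: degree_def deg_in_def incident_edges_def)

lemma deg_in_empty [simp]: "deg_in G {} v = 0"
  by (simp add: deg_in_def)

lemma deg_in_insert:
  assumes "finite A" "e \<notin> A"
  shows "deg_in G (insert e A) v = deg_in G A v + (if v \<in> ends G e then 1 else 0)"
proof (cases "v \<in> ends G e")
  case True
  then have "{a \<in> insert e A. v \<in> ends G a} = insert e {a \<in> A. v \<in> ends G a}" by auto
  then show ?thesis using assms True by (simp add: deg_in_def)
next
  case False
  then have "{a \<in> insert e A. v \<in> ends G a} = {a \<in> A. v \<in> ends G a}" by auto
  then show ?thesis using False by (simp add: deg_in_def)
qed

lemma deg_in_Un:
  assumes "finite A" "finite B" "A \<inter> B = {}"
  shows "deg_in G (A \<union> B) v = deg_in G A v + deg_in G B v"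
proof -
  have "{e \<in> A \<union> B. v \<in> ends G e} = {e \<in> A. v \<in> ends G e} \<union> {e \<in> B. v \<in> ends G e}" by auto
  then show ?thesis using assms unfolding deg_in_def by (auto intro!: card_Un_disjoint)
qed

lemma odd_deg_in_sym_diff:
  assumes "finite A" "finite B"
  shows "odd (deg_in G (sym_diff A B) v) \<longleftrightarrow> odd (deg_in G A v) \<noteq> odd (deg_in G B v)"
proof -
  have 1: "deg_in G A v = deg_in G (A - B) v + deg_in G (A \<inter> B) v"
    using deg_in_Un[of "A - B" "A \<inter> B" G v] assms by (simp add: Un_Diff_Int Int_Diff_disjoint Diff_Int_distrib2 Int_commute)
  have 2: "deg_in G B v = deg_in G (B - A) v + deg_in G (A \<inter> B) v"
    using deg_in_Un[of "B - A" "A \<inter> B" G v] assms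
    by (simp add: Un_Diff_Int Int_commute) (metis Diff_disjoint Int_Diff Int_commute inf_left_commute Int_empty_right Un_Diff_Int)
  have "deg_in G (sym_diff A B) v = deg_in G (A - B) v + deg_in G (B - A) v"
    using assms by (intro deg_in_Un) auto
  then show ?thesis using 1 2 by presburger
qed

lemma even_set_sym_diff:
  assumes "finite (edges G)" "even_set G A" "even_set G B"
  shows "even_set G (sym_diff A B)"
proof -
  have "finite A" "finite B"
    using assms finite_subset unfolding even_set_def by auto
  then show ?thesis using assms odd_deg_in_sym_diff[of A B G] unfolding even_set_def by blast
qed

text \<open>
  Every edge contributes 0, 1 or 2 to the sum, and 1 precisely if it joins \<open>X\<close> to its complement.
\<close>

lemma handshake:
  assumes "finite A" "finite X" "\<And>e. e \<in> A \<Longrightarrow> card (ends G e) = 2"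
  shows "even (\<Sum>v\<in>X. deg_in G A v) \<longleftrightarrow>
    even (card {e \<in> A. ends G e \<inter> X \<noteq> {} \<and> ends G e - X \<noteq> {}})"
  using assms(1,3)
proof (induction A rule: finite_induct)
  case empty
  then show ?case by simp
next
  case (insert e A)
  let ?cr = "\<lambda>e. ends G e \<inter> X \<noteq> {} \<and> ends G e - X \<noteq> {}"
  have "(\<Sum>v\<in>X. deg_in G (insert e A) v) = (\<Sum>v\<in>X. deg_in G A v) + card (X \<inter> ends G e)"
    using insert.hyps assms(2) by (simp add: deg_in_insert sum.distrib flip: sum.inter_restrict)
  moreover have "odd (card (X \<inter> ends G e)) \<longleftrightarrow> ?cr e"
  proof -
    obtain u v where uv: "ends G e = {u, v}" "u \<noteq> v"
      using insert.prems[of e] card_2_iff by (metis insertI1)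
    then have "X \<inter> ends G e = (if u \<in> X then {u} else {}) \<union> (if v \<in> X then {v} else {})" by auto
    then show ?thesis using uv by auto
  qed
  moreover have "card {e' \<in> insert e A. ?cr e'} = card {e' \<in> A. ?cr e'} + (if ?cr e then 1 else 0)"
  proof (cases "?cr e")
    case True
    then have "{e' \<in> insert e A. ?cr e'} = insert e {e' \<in> A. ?cr e'}" by auto
    then show ?thesis using insert.hyps True by simp
  next
    case False
    then have "{e' \<in> insert e A. ?cr e'} = {e' \<in> A. ?cr e'}" by auto
    then show ?thesis using False by simp
  qed
  ultimately show ?case using insert.IH insert.prems by auto
qed

section \<open>Components\<close>

definition spanning :: "('v, 'e) mgraph \<Rightarrow> 'e set \<Rightarrow> ('v, 'e) mgraph" where
  "spanning G A = \<lparr>verts = verts G, edges = A, ends = ends G\<rparr>"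

definition component_at :: "('v, 'e) mgraph \<Rightarrow> 'v \<Rightarrow> ('v, 'e) mgraph" where
  "component_at G v = \<lparr>verts = (adjacency G)\<^sup>* `` {v},
     edges = {e \<in> edges G. ends G e \<subseteq> (adjacency G)\<^sup>* `` {v}}, ends = ends G\<rparr>"

lemma spanning_simps [simp]:
  "verts (spanning G A) = verts G" "edges (spanning G A) = A" "ends (spanning G A) = ends G"
  by (simp_all add: spanning_def)

lemma component_at_simps [simp]:
  "verts (component_at G v) = (adjacency G)\<^sup>* `` {v}"
  "edges (component_at G v) = {e \<in> edges G. ends G e \<subseteq> (adjacency G)\<^sup>* `` {v}}"
  "ends (component_at G v) = ends G"
  by (simp_all add: component_at_def)

lemma multigraph_spanning: "multigraph G \<Longrightarrow> A \<subseteq> edges G \<Longrightarrow> multigraph (spanning G A)"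
  by (auto simp: multigraph_def intro: finite_subset)

lemma adjacencyI: "e \<in> edges G \<Longrightarrow> ends G e = {u, v} \<Longrightarrow> (u, v) \<in> adjacency G"
  by (auto simp: adjacency_def)

lemma adjacencyI':
  assumes "multigraph G" "e \<in> edges G" "u \<in> ends G e" "v \<in> ends G e" "u \<noteq> v"
  shows "(u, v) \<in> adjacency G"
proof -
  obtain x y where "ends G e = {x, y}" by (rule edge_endsE[OF assms(1,2)])
  then have "ends G e = {u, v}" using assms(3-5) by auto
  then show ?thesis by (rule adjacencyI[OF assms(2)])
qed

lemma sym_adjacency: "sym (adjacency G)"
  by (auto simp: adjacency_def sym_def insert_commute)

lemma reach_sym: "(u, v) \<in> (adjacency G)\<^sup>* \<Longrightarrow> (v, u) \<in> (adjacency G)\<^sup>*"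
  using sym_adjacency sym_rtrancl symD by metis

lemma adjacency_mono:
  "edges H \<subseteq> edges G \<Longrightarrow> ends H = ends G \<Longrightarrow> adjacency H \<subseteq> adjacency G"
  by (auto simp: adjacency_def)

lemma reach_in_verts:
  assumes "multigraph G" "(u, v) \<in> (adjacency G)\<^sup>*" "u \<in> verts G"
  shows "v \<in> verts G"
  using assms(2,3)
proof (induction rule: rtrancl_induct)
  case (step y z)
  then obtain e where "e \<in> edges G" "ends G e = {y, z}" by (auto simp: adjacency_def)
  then show ?case using multigraphD(3)[OF assms(1), of e] by simp
qed

lemma edge_reach:
  assumes "multigraph G" "e \<in> edges G" "u \<in> ends G e"
  shows "ends G e \<subseteq> (adjacency G)\<^sup>* `` {u}"
proof
  fix v assume "v \<in> ends G e"
  then show "v \<in> (adjacency G)\<^sup>* `` {u}"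
    using adjacencyI'[OF assms, of v] by (cases "u = v") auto
qed

lemma edge_reach_iff:
  assumes "multigraph G" "e \<in> edges G" "u \<in> ends G e"
  shows "ends G e \<subseteq> (adjacency G)\<^sup>* `` {v} \<longleftrightarrow> (v, u) \<in> (adjacency G)\<^sup>*"
proof
  assume "(v, u) \<in> (adjacency G)\<^sup>*"
  then have "(adjacency G)\<^sup>* `` {u} \<subseteq> (adjacency G)\<^sup>* `` {v}" using rtrancl_trans by fast
  then show "ends G e \<subseteq> (adjacency G)\<^sup>* `` {v}" using edge_reach[OF assms] by (rule subset_trans[rotated])
qed (use assms(3) in auto)

lemma component_at_eq:
  assumes "(u, v) \<in> (adjacency G)\<^sup>*"
  shows "component_at G u = component_at G v"
proof -
  have "(adjacency G)\<^sup>* `` {u} = (adjacency G)\<^sup>* `` {v}"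
    using rtrancl_trans[OF assms] rtrancl_trans[OF reach_sym[OF assms]] by blast
  then show ?thesis by (simp add: component_at_def)
qed

lemma subgraph_component_at:
  "multigraph G \<Longrightarrow> v \<in> verts G \<Longrightarrow> subgraph (component_at G v) G"
  using reach_in_verts[of G v] by (auto simp: subgraph_def)

lemma subgraphD:
  assumes "subgraph H G"
  shows "verts H \<subseteq> verts G" "edges H \<subseteq> edges G" "ends H = ends G"
    "e \<in> edges H \<Longrightarrow> ends G e \<subseteq> verts H"
  using assms unfolding subgraph_def by (blast, blast, blast, metis)

lemma multigraph_subgraph:
  assumes "multigraph G" "subgraph H G"
  shows "multigraph H"
  using multigraphD[OF assms(1)] subgraphD[OF assms(2)]
  by (auto simp: multigraph_def intro: finite_subset)

lemma connected_component_at: "connected_graph (component_at G v)"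
proof -
  have *: "(v, u) \<in> (adjacency (component_at G v))\<^sup>*" if "(v, u) \<in> (adjacency G)\<^sup>*" for u
    using that
  proof (induction rule: rtrancl_induct)
    case (step y z)
    then obtain e where e: "e \<in> edges G" "ends G e = {y, z}" by (auto simp: adjacency_def)
    have "(v, z) \<in> (adjacency G)\<^sup>*" using step.hyps by auto
    then have "(y, z) \<in> adjacency (component_at G v)"
      using e step.hyps by (intro adjacencyI[of e]) auto
    then show ?case using step.IH by auto
  qed simp
  show ?thesis
    unfolding connected_graph_def using rtrancl_trans[OF reach_sym[OF *] *] by auto
qed

lemma connected_subgraph_component_at:
  assumes "subgraph D G" "connected_graph D" "v \<in> verts D"
  shows "subgraph D (component_at G v)"
proof -
  have "(adjacency D)\<^sup>* \<subseteq> (adjacency G)\<^sup>*"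
    using assms(1) by (intro rtrancl_mono adjacency_mono) (auto simp: subgraph_def)
  then have "verts D \<subseteq> (adjacency G)\<^sup>* `` {v}"
    using assms(2,3) by (auto simp: connected_graph_def)
  moreover have "ends G e \<subseteq> (adjacency G)\<^sup>* `` {v}" if "e \<in> edges D" for e
    using subgraphD(4)[OF assms(1) that] calculation by (rule subset_trans)
  ultimately show ?thesis
    using subgraphD[OF assms(1)] unfolding subgraph_def by auto
qed

lemma subgraph_antisym: "subgraph C D \<Longrightarrow> subgraph D C \<Longrightarrow> C = D"
  unfolding subgraph_def by (intro mgraph.equality) auto

lemma component_eq_component_at:
  assumes "multigraph G" "component G C" "v \<in> verts C"
  shows "C = component_at G v"
proof -
  have C: "subgraph C G" "connected_graph C"
    "\<And>D. subgraph D G \<Longrightarrow> connected_graph D \<Longrightarrow> subgraph C D \<Longrightarrow> D = C"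
    using assms(2) by (auto simp: component_def)
  have "v \<in> verts G" using subgraphD(1)[OF C(1)] assms(3) by auto
  then show ?thesis
    using C(3)[OF subgraph_component_at[OF assms(1)] connected_component_at
        connected_subgraph_component_at[OF C(1,2) assms(3)]] by simp
qed

lemma component_component_at:
  assumes "multigraph G" "v \<in> verts G"
  shows "component G (component_at G v)"
  unfolding component_def
proof (intro conjI allI impI, goal_cases)
  case 1
  then show ?case by (rule subgraph_component_at[OF assms])
next
  case 2
  then show ?case by (rule connected_component_at)
next
  case (3 D)
  then have D: "subgraph D G" "connected_graph D" "subgraph (component_at G v) D" by auto
  have "v \<in> verts D" using subgraphD(1)[OF D(3)] by auto
  then show ?case
    using subgraph_antisym[OF _ D(3)] connected_subgraph_component_at[OF D(1,2)] by simp
qed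

section \<open>Even double covers and cycle double covers\<close>

text \<open>
  An even degree that is neither 0 nor above 3 equals 2, so the nontrivial components of an even set
  in a cubic graph are cycles.
\<close>

lemma component_at_even_set_cycle:
  assumes G: "multigraph G" "cubic G" and A: "even_set G A"
    and v: "v \<in> verts G" "e \<in> A" "v \<in> ends G e"
  shows "cycle_of G (component_at (spanning G A) v)" (is "cycle_of G ?C")
proof -
  have m: "multigraph (spanning G A)"
    using G A by (auto intro: multigraph_spanning simp: even_set_def)
  have s: "subgraph ?C (spanning G A)" using m v by (auto intro: subgraph_component_at)
  have deg: "degree ?C u = deg_in G A u" if "u \<in> verts ?C" for u
    using that edge_reach_iff[OF m, of _ u v]
    unfolding degree_def deg_in_def incident_edges_def by (intro arg_cong[of _ _ card]) auto
  have two: "deg_in G A u = 2" if u: "u \<in> verts ?C" for u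
  proof -
    have uG: "u \<in> verts G" using u s by (auto simp: subgraph_def)
    have "deg_in G A u \<le> deg_in G (edges G) u"
      unfolding deg_in_def using A multigraphD(2)[OF G(1)]
      by (intro card_mono) (auto simp: even_set_def)
    then have "deg_in G A u \<le> 3" using G(2) uG by (simp add: regular_def degree_eq)
    moreover have "even (deg_in G A u)" using A uG by (simp add: even_set_def)
    moreover have "deg_in G A u \<noteq> 0"
    proof -
      have "\<exists>e'\<in>A. u \<in> ends G e'"
      proof (cases "u = v")
        case False
        have "(v, u) \<in> (adjacency (spanning G A))\<^sup>*" using u by simp
        then obtain w where "(w, u) \<in> adjacency (spanning G A)" using False by (metis rtranclE)
        then show ?thesis by (auto simp: adjacency_def)
      qed (use v in auto)
      moreover have "finite A" using A G finite_subset by (auto simp: even_set_def multigraph_def)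
      ultimately show ?thesis by (auto simp: deg_in_def)
    qed
    ultimately show ?thesis by presburger
  qed
  have "subgraph ?C G" using s A by (auto simp: subgraph_def even_set_def)
  moreover have "is_cycle ?C"
    using multigraph_subgraph[OF m s] connected_component_at deg two
    by (auto simp: is_cycle_def regular_def)
  ultimately show ?thesis by (simp add: cycle_of_def)
qed

text \<open>
  The components of the even sets are cycles, and an edge lies in one component of each of the two
  sets containing it. These two components differ: if they were the same cycle, then the third edge
  at one of its vertices \<open>v\<close> would have to be covered by yet another set, in which it would be the only
  edge at \<open>v\<close>.
\<close>

theorem cycle_double_cover_if_even_double_cover:
  assumes G: "multigraph G" "cubic G" and "even_double_cover G"
  shows "\<exists>S. cycle_double_cover G S"
proof -
  obtain I :: "nat set" and A where I: "finite I" and A: "\<And>i. i \<in> I \<Longrightarrow> even_set G (A i)"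
    and two: "\<And>e. e \<in> edges G \<Longrightarrow> card {i \<in> I. e \<in> A i} = 2"
    using assms(3) unfolding even_double_cover_def by auto
  define K where "K i v = component_at (spanning G (A i)) v" for i v
  define S where "S = {K i v |i v. i \<in> I \<and> v \<in> verts G \<and> (\<exists>e\<in>A i. v \<in> ends G e)}"
  have cyc: "cycle_of G C" if C: "C \<in> S" for C
  proof -
    obtain i v e where "C = K i v" "i \<in> I" "v \<in> verts G" "e \<in> A i" "v \<in> ends G e"
      using C unfolding S_def by blast
    then show ?thesis using component_at_even_set_cycle[OF G A, of i v e] by (simp add: K_def)
  qed
  have m: "multigraph (spanning G (A i))" if "i \<in> I" for i
    using G A[OF that] by (auto intro: multigraph_spanning simp: even_set_def)
  have "card {C \<in> S. e \<in> edges C} = 2" if e: "e \<in> edges G" for e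
  proof -
    obtain v w where vw: "ends G e = {v, w}" "v \<in> verts G" using edge_endsE[OF G(1) e] by metis
    have v: "v \<in> ends G e" using vw by simp
    have "{C \<in> S. e \<in> edges C} = (\<lambda>i. K i v) ` {i \<in> I. e \<in> A i}"
    proof (intro equalityI subsetI)
      fix C assume "C \<in> {C \<in> S. e \<in> edges C}"
      then obtain i u where i: "i \<in> I" "C = K i u" "e \<in> edges C" by (auto simp: S_def)
      then have e': "e \<in> A i" and "(u, v) \<in> (adjacency (spanning G (A i)))\<^sup>*"
        using v by (auto simp: K_def)
      then have "C = K i v" using i(2) component_at_eq unfolding K_def by metis
      then show "C \<in> (\<lambda>i. K i v) ` {i \<in> I. e \<in> A i}" using i(1) e' by blast
    next
      fix C assume "C \<in> (\<lambda>i. K i v) ` {i \<in> I. e \<in> A i}"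
      then obtain i where i: "i \<in> I" "e \<in> A i" "C = K i v" by auto
      show "C \<in> {C \<in> S. e \<in> edges C}"
      proof -
        have "C \<in> S" unfolding S_def using i v vw(2) by blast
        moreover have "e \<in> edges C" using edge_reach[OF m, of i e v] i v by (simp add: K_def)
        ultimately show ?thesis by simp
      qed
    qed
    moreover have "inj_on (\<lambda>i. K i v) {i \<in> I. e \<in> A i}"
    proof (rule inj_onI, rule ccontr)
      fix i j assume ij: "i \<in> {i \<in> I. e \<in> A i}" "j \<in> {i \<in> I. e \<in> A i}" "K i v = K j v" "i \<noteq> j"
      have sub_i: "edges (K i v) \<subseteq> A i" by (auto simp: K_def)
      have "edges (K j v) \<subseteq> A j" by (auto simp: K_def)
      then have sub_j: "edges (K i v) \<subseteq> A j" using ij(3) by simp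
      \<comment> \<open>the edges of the common cycle at \<open>v\<close> are covered by \<open>A i\<close> and \<open>A j\<close> only\<close>
      have excl: "{k \<in> I. a \<in> A k} = {i, j}" if "a \<in> edges (K i v)" for a
      proof -
        have "{i, j} \<subseteq> {k \<in> I. a \<in> A k}" using that ij sub_i sub_j by blast
        moreover have "a \<in> edges G" using that sub_i A[of i] ij unfolding even_set_def by blast
        then have "card {i, j} = card {k \<in> I. a \<in> A k}" using two ij(4) by simp
        moreover have "finite {k \<in> I. a \<in> A k}" using I by simp
        ultimately show ?thesis using card_subset_eq by metis
      qed
      have "K i v \<in> S" using ij v vw(2) unfolding S_def by blast
      then have c: "cycle_of G (K i v)" by (rule cyc)
      have "v \<in> verts (K i v)" by (simp add: K_def)
      then have "card (incident_edges (K i v) v) = 2"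
        using c by (simp add: cycle_of_def is_cycle_def regular_def degree_def)
      moreover have sub: "incident_edges (K i v) v \<subseteq> incident_edges G v"
        using sub_i A[of i] ij(1) by (auto simp: incident_edges_def even_set_def K_def)
      moreover have "card (incident_edges G v) = 3" using G(2) vw(2) by (simp add: regular_def degree_def)
      moreover have fin: "finite (incident_edges G v)"
        using multigraphD(2)[OF G(1)] by (simp add: incident_edges_def)
      ultimately have "card (incident_edges G v - incident_edges (K i v) v) = 1"
        by (simp add: card_Diff_subset finite_subset)
      then obtain b where b: "incident_edges G v - incident_edges (K i v) v = {b}"
        by (auto simp: card_1_singleton_iff)
      then have bG: "b \<in> edges G" "v \<in> ends G b" by (auto simp: incident_edges_def)
      have "{k \<in> I. b \<in> A k} \<noteq> {}" using two[OF bG(1)] by (metis card.empty zero_neq_numeral)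
      then obtain k where k: "k \<in> I" "b \<in> A k" by auto
      have "b \<notin> A i" if "b \<in> A i"
      proof -
        have "b \<in> edges (K i v)" using edge_reach[OF m, of i b v] that bG(2) ij(1) by (simp add: K_def)
        then have "b \<in> incident_edges (K i v) v" using bG(2) by (simp add: incident_edges_def K_def)
        then show ?thesis using b by blast
      qed
      moreover have "b \<notin> A j" if "b \<in> A j"
      proof -
        have "b \<in> edges (K j v)" using edge_reach[OF m, of j b v] that bG(2) ij(2) by (simp add: K_def)
        then have "b \<in> incident_edges (K j v) v" using bG(2) by (simp add: incident_edges_def K_def)
        then show ?thesis using b ij(3) by auto
      qed
      ultimately have kij: "k \<noteq> i" "k \<noteq> j" using k by auto
      have "{a \<in> A k. v \<in> ends G a} = {b}"
      proof -
        have "a = b" if a: "a \<in> A k" "v \<in> ends G a" for a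
        proof (rule ccontr)
          assume "a \<noteq> b"
          moreover have "a \<in> incident_edges G v" using a A[OF k(1)] by (auto simp: incident_edges_def even_set_def)
          ultimately have "a \<in> edges (K i v)" using b by (auto simp: incident_edges_def)
          then have "k \<in> {i, j}" using excl[of a] a k by blast
          then show False using kij by simp
        qed
        then show ?thesis using k(2) bG(2) by blast
      qed
      then have "deg_in G (A k) v = 1" by (simp add: deg_in_def)
      then show False using A[OF k(1)] vw(2) by (auto simp: even_set_def)
    qed
    ultimately show ?thesis using two[OF e] by (simp add: card_image)
  qed
  then show ?thesis using cyc unfolding cycle_double_cover_def by blast
qed

section \<open>Edge cuts and contractions\<close>

text \<open>
  Formulated with vertex sets, so that it passes to contractions directly. The case of an empty
  boundary makes the graph connected.
\<close>

definition two_edge_connected :: "('v, 'e) mgraph \<Rightarrow> bool" where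
  "two_edge_connected G \<longleftrightarrow>
     (\<forall>X. X \<subseteq> verts G \<and> X \<noteq> {} \<and> X \<noteq> verts G \<longrightarrow> card (boundary G X) \<ge> 2)"

lemma boundary_complement:
  assumes "multigraph G"
  shows "boundary G (verts G - X) = boundary G X"
  using multigraphD(3)[OF assms] by (auto simp: boundary_def)

lemma boundary_singleton:
  assumes "multigraph G"
  shows "boundary G {x} = incident_edges G x"
proof -
  have "\<not> ends G e \<subseteq> {x}" if e: "e \<in> edges G" for e
    using multigraphD(4)[OF assms e] card_mono[of "{x}" "ends G e"] by auto
  then show ?thesis by (auto simp: boundary_def incident_edges_def)
qed

lemma finite_boundary: "multigraph G \<Longrightarrow> finite (boundary G X)"
  by (simp add: boundary_def multigraph_def)

lemma reach_closed:
  assumes "boundary G X = {}" "(u, v) \<in> (adjacency G)\<^sup>*" "u \<in> X"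
  shows "v \<in> X"
  using assms(2,3)
proof (induction rule: rtrancl_induct)
  case (step y z)
  then obtain e where "e \<in> edges G" "ends G e = {y, z}" by (auto simp: adjacency_def)
  moreover have "e \<notin> boundary G X" using assms(1) by simp
  ultimately show ?case using step by (auto simp: boundary_def)
qed

text \<open>
  If \<open>xy\<close> is the only edge between \<open>X\<close> and its complement, then deleting \<open>x\<close> separates \<open>y\<close>
  from \<open>X - {x}\<close>. So \<open>X = {x}\<close>, but then three edges leave \<open>X\<close>.
\<close>

lemma two_edge_connected_if_two_connected:
  assumes G: "multigraph G" "cubic G" and "two_connected G"
  shows "two_edge_connected G"
  unfolding two_edge_connected_def
proof (intro allI impI, rule ccontr)
  fix X assume X: "X \<subseteq> verts G \<and> X \<noteq> {} \<and> X \<noteq> verts G" and "\<not> 2 \<le> card (boundary G X)"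
  then consider "card (boundary G X) = 0" | "card (boundary G X) = 1" by linarith
  then show False
  proof cases
    case 1
    obtain u v where uv: "u \<in> X" "v \<in> verts G" "v \<notin> X" using X by blast
    have "(u, v) \<in> (adjacency G)\<^sup>*"
      using assms(3) uv X by (auto simp: two_connected_def connected_graph_def)
    moreover have "boundary G X = {}" using 1 finite_boundary[OF G(1)] by simp
    ultimately show False using reach_closed uv by metis
  next
    case 2
    then obtain e where e: "boundary G X = {e}" by (auto simp: card_1_singleton_iff)
    then have "e \<in> boundary G X" by simp
    then obtain x y where eG: "e \<in> edges G"
      and x: "x \<in> ends G e" "x \<in> X" and y: "y \<in> ends G e" "y \<notin> X"
      unfolding boundary_def by blast
    have V: "x \<in> verts G" "y \<in> verts G" using multigraphD(3)[OF G(1) eG] x y by auto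
    let ?H = "delete_vertex G x"
    have "boundary ?H (X - {x}) \<subseteq> boundary G X - incident_edges G x"
      by (auto simp: boundary_def delete_vertex_def incident_edges_def)
    then have closed: "boundary ?H (X - {x}) = {}" using e x(1) eG by (auto simp: incident_edges_def)
    have "X = {x}"
    proof (rule ccontr)
      assume "X \<noteq> {x}"
      then obtain u where u: "u \<in> X - {x}" using x(2) by auto
      have "connected_graph ?H" using assms(3) V by (simp add: two_connected_def)
      moreover have "u \<in> verts ?H" "y \<in> verts ?H" using u y(2) x(2) V X by (auto simp: delete_vertex_def)
      ultimately have "(u, y) \<in> (adjacency ?H)\<^sup>*" by (simp add: connected_graph_def)
      then show False using reach_closed[OF closed _ u] y(2) by blast
    qed
    then have "card (boundary G X) = 3"
      using boundary_singleton[OF G(1)] G(2) V(1) by (simp add: regular_def degree_def)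
    then show False using 2 by simp
  qed
qed

lemma connected_if_two_edge_connected:
  assumes G: "multigraph G" "verts G \<noteq> {}" "two_edge_connected G"
  shows "connected_graph G"
  unfolding connected_graph_def
proof (intro conjI ballI)
  fix u v assume uv: "u \<in> verts G" "v \<in> verts G"
  let ?X = "(adjacency G)\<^sup>* `` {u}"
  have "boundary G ?X = {}"
    using edge_reach_iff[OF G(1)] by (auto simp: boundary_def)
  moreover have "?X \<subseteq> verts G" using reach_in_verts[OF G(1)] uv by auto
  ultimately have "?X = verts G" using G(3) unfolding two_edge_connected_def
    by (metis Image_singleton_iff card.empty empty_iff not_numeral_le_zero rtrancl.rtrancl_refl)
  then show "(u, v) \<in> (adjacency G)\<^sup>*" using uv by auto
qed (use G in simp)

text \<open>
  One of the two components serves as \<open>X\<close>. Without loops, a cycle has at least two vertices,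
  so both sides of the cut do.
\<close>

lemma small_cut_if_not_cyclically_4_edge_connected:
  assumes G: "multigraph G" "connected_graph G" and no: "\<not> cyclically_edge_connected 4 G"
  obtains X where "X \<subseteq> verts G" "card X \<ge> 2" "card (verts G - X) \<ge> 2" "card (boundary G X) \<le> 3"
proof -
  obtain A C D Z Z' where A: "A \<subseteq> edges G" "card A < 4"
    and CD: "component (delete_edges G A) C" "component (delete_edges G A) D" "C \<noteq> D"
    and Z: "cycle_of C Z" "cycle_of D Z'"
    using no G(2) unfolding cyclically_edge_connected_def by blast
  let ?H = "delete_edges G A"
  have H: "multigraph ?H" using G(1) by (auto simp: multigraph_def delete_edges_def)
  have large: "card (verts B) \<ge> 2" and sub: "verts B \<subseteq> verts G"
    if B: "component ?H B" "cycle_of B Y" for B Y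
  proof -
    have BH: "subgraph B ?H" using B(1) by (simp add: component_def)
    then show BG: "verts B \<subseteq> verts G" by (auto simp: subgraph_def delete_edges_def)
    have Y: "subgraph Y B" "multigraph Y" "connected_graph Y" "regular 2 Y"
      using B(2) by (auto simp: cycle_of_def is_cycle_def)
    then obtain v where v: "v \<in> verts Y" by (auto simp: connected_graph_def)
    have "incident_edges Y v \<noteq> {}"
      using Y(4) v unfolding regular_def degree_def by (metis card.empty zero_neq_numeral)
    then obtain e where "e \<in> edges Y" by (auto simp: incident_edges_def)
    then have "card (ends Y e) = 2" "ends Y e \<subseteq> verts B"
      using multigraphD(3,4)[OF Y(2)] subgraphD(1)[OF Y(1)] by blast+
    moreover have "finite (verts B)" using BG multigraphD(1)[OF G(1)] finite_subset by auto
    ultimately show "card (verts B) \<ge> 2" using card_mono by metis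
  qed
  have "verts C \<inter> verts D = {}"
    using component_eq_component_at[OF H] CD by blast
  then have "verts D \<subseteq> verts G - verts C" using sub[OF CD(2) Z(2)] by auto
  then have "card (verts G - verts C) \<ge> 2"
    using large[OF CD(2) Z(2)] card_mono[of "verts G - verts C" "verts D"] multigraphD(1)[OF G(1)] by auto
  moreover have "boundary G (verts C) \<subseteq> A"
  proof
    fix e assume e: "e \<in> boundary G (verts C)"
    show "e \<in> A"
    proof (rule ccontr)
      assume "e \<notin> A"
      then have eH: "e \<in> edges ?H" using e by (simp add: boundary_def delete_edges_def)
      obtain u where u: "u \<in> ends G e" "u \<in> verts C" using e by (auto simp: boundary_def)
      have "verts C = (adjacency ?H)\<^sup>* `` {u}"
        using component_eq_component_at[OF H CD(1) u(2)] by (metis component_at_simps(1))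
      then have "ends G e \<subseteq> verts C"
        using edge_reach[OF H eH, of u] u(1) by (simp add: delete_edges_def)
      then show False using e by (auto simp: boundary_def)
    qed
  qed
  moreover have "finite A" using A(1) multigraphD(2)[OF G(1)] finite_subset by auto
  ultimately have "card (boundary G (verts C)) \<le> card A" "card (verts G - verts C) \<ge> 2"
    using card_mono by auto
  then show thesis using that[of "verts C"] large[OF CD(1) Z(1)] sub[OF CD(1) Z(1)] A(2) by auto
qed

text \<open>
  The new vertex is named after an element \<open>x\<close> of \<open>X\<close>, so that the vertex type stays the same and
  the induction can be repeated.
\<close>

definition contract :: "('v, 'e) mgraph \<Rightarrow> 'v set \<Rightarrow> 'v \<Rightarrow> ('v, 'e) mgraph" where
  "contract G X x = \<lparr>verts = insert x (verts G - X), edges = {e \<in> edges G. \<not> ends G e \<subseteq> X},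
     ends = (\<lambda>e. (\<lambda>v. if v \<in> X then x else v) ` ends G e)\<rparr>"

lemma contract_simps [simp]:
  "verts (contract G X x) = insert x (verts G - X)"
  "edges (contract G X x) = {e \<in> edges G. \<not> ends G e \<subseteq> X}"
  "ends (contract G X x) e = (\<lambda>v. if v \<in> X then x else v) ` ends G e"
  by (simp_all add: contract_def)

lemma multigraph_contract:
  assumes G: "multigraph G" and X: "X \<subseteq> verts G" "x \<in> X"
  shows "multigraph (contract G X x)"
  unfolding multigraph_def
proof (intro conjI ballI)
  fix e assume "e \<in> edges (contract G X x)"
  then have e: "e \<in> edges G" "\<not> ends G e \<subseteq> X" by auto
  obtain u v where uv: "ends G e = {u, v}" "u \<noteq> v" "u \<in> verts G" "v \<in> verts G"
    by (rule edge_endsE[OF G e(1)])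
  have "u \<notin> X \<or> v \<notin> X" using e(2) uv(1) by simp
  then have "(if u \<in> X then x else u) \<noteq> (if v \<in> X then x else v)" using uv(2) X(2) by auto
  then show "card (ends (contract G X x) e) = 2"
    unfolding contract_simps uv(1) image_insert image_empty by (simp only: card_2_iff) blast
  show "ends (contract G X x) e \<subseteq> verts (contract G X x)" 
    unfolding contract_simps uv(1) image_insert image_empty using uv(3,4) by simp
qed (use multigraphD[OF G] in auto)

lemma deg_in_contract_outside:
  assumes "x \<in> X" "v \<notin> X"
  shows "deg_in (contract G X x) A v = deg_in G A v"
  unfolding deg_in_def using assms by (intro arg_cong[of _ _ card]) auto

lemma deg_in_contract_new:
  assumes "x \<in> X" "A \<subseteq> edges (contract G X x)"
  shows "deg_in (contract G X x) A x = card (A \<inter> boundary G X)"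
  unfolding deg_in_def using assms by (intro arg_cong[of _ _ card]) (auto simp: boundary_def)

lemma cubic_contract:
  assumes G: "cubic G" and X: "x \<in> X" "card (boundary G X) = 3"
  shows "cubic (contract G X x)"
  unfolding regular_def
proof
  fix v assume v: "v \<in> verts (contract G X x)"
  show "degree (contract G X x) v = 3"
  proof (cases "v = x")
    case True
    have "edges (contract G X x) \<inter> boundary G X = boundary G X" by (auto simp: boundary_def)
    then show ?thesis using True deg_in_contract_new[OF X(1), of "edges (contract G X x)" G] X(2)
      by (simp add: degree_eq)
  next
    case False
    then have v': "v \<in> verts G" "v \<notin> X" using v by auto
    then have "{e \<in> edges (contract G X x). v \<in> ends G e} = {e \<in> edges G. v \<in> ends G e}" by auto
    then have "deg_in G (edges (contract G X x)) v = deg_in G (edges G) v" by (simp only: deg_in_def)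
    then show ?thesis using G v'(1)
      unfolding degree_eq deg_in_contract_outside[OF X(1) v'(2)] regular_def by simp
  qed
qed

text \<open>
  The boundary of a vertex set in the contraction is the boundary of its preimage.
\<close>

lemma two_edge_connected_contract:
  assumes G: "multigraph G" "two_edge_connected G" and X: "X \<subseteq> verts G" "x \<in> X"
  shows "two_edge_connected (contract G X x)"
  unfolding two_edge_connected_def
proof (intro allI impI)
  fix Z assume Z: "Z \<subseteq> verts (contract G X x) \<and> Z \<noteq> {} \<and> Z \<noteq> verts (contract G X x)"
  define q where "q v = (if v \<in> X then x else v)" for v
  define Y where "Y = {v \<in> verts G. q v \<in> Z}"
  have fix_q: "q z = z" "z \<in> verts G" if "z \<in> verts (contract G X x)" for z
    using that X by (auto simp: q_def)
  obtain z where z: "z \<in> Z" "z \<in> verts (contract G X x)" using Z by blast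
  then have "z \<in> Y" using fix_q[OF z(2)] by (simp add: Y_def)
  obtain w where w: "w \<notin> Z" "w \<in> verts (contract G X x)" using Z by blast
  then have "w \<in> verts G - Y" using fix_q[OF w(2)] by (simp add: Y_def)
  then have "Y \<subseteq> verts G" "Y \<noteq> {}" "Y \<noteq> verts G" using \<open>z \<in> Y\<close> by (auto simp: Y_def)
  then have "2 \<le> card (boundary G Y)" using G(2) unfolding two_edge_connected_def by blast
  moreover have "boundary (contract G X x) Z = boundary G Y"
  proof -
    have "e \<in> boundary (contract G X x) Z \<longleftrightarrow> e \<in> boundary G Y" for e
    proof (cases "e \<in> edges G")
      case True
      have "ends (contract G X x) e = q ` ends G e" by (simp add: q_def)
      moreover have "q ` ends G e \<inter> Z \<noteq> {} \<longleftrightarrow> ends G e \<inter> Y \<noteq> {}"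
        "q ` ends G e - Z \<noteq> {} \<longleftrightarrow> ends G e - Y \<noteq> {}"
        using multigraphD(3)[OF G(1) True] unfolding Y_def by blast+
      moreover have "ends G e \<inter> Y = {} \<or> ends G e - Y = {}" if "ends G e \<subseteq> X"
      proof -
        have "q v = x" if "v \<in> ends G e" for v using \<open>ends G e \<subseteq> X\<close> that by (auto simp: q_def)
        then show ?thesis using multigraphD(3)[OF G(1) True] unfolding Y_def by force
      qed
      ultimately show ?thesis using True by (auto simp: boundary_def simp del: contract_simps(3))
    qed (simp add: boundary_def)
    then show ?thesis by (rule set_eqI)
  qed
  ultimately show "2 \<le> card (boundary (contract G X x) Z)" by simp
qed

section \<open>Gluing even double covers along small cuts\<close>

text \<open>
  Let \<open>S e\<close> consist of the indices of the sets containing \<open>e\<close>. For \<open>D = {a, b, c}\<close> parity makes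
  \<open>S c\<close> the symmetric difference of \<open>S a\<close> and \<open>S b\<close>. All three have two elements, hence \<open>S a\<close> and
  \<open>S b\<close> have exactly one element in common.
\<close>

lemma trace_on_three_edges_unique:
  assumes I: "finite I" and D: "card D = 3"
    and ev: "\<And>i. i \<in> I \<Longrightarrow> even (card (A i \<inter> D))"
    and two: "\<And>e. e \<in> D \<Longrightarrow> card {i \<in> I. e \<in> A i} = 2"
    and T: "T \<subseteq> D" "card T = 2"
  shows "card {i \<in> I. A i \<inter> D = T} = 1"
proof -
  have finD: "finite D" using D card.infinite by fastforce
  obtain a b where ab: "T = {a, b}" "a \<noteq> b" using T(2) by (meson card_2_iff)
  have "card (D - T) = 1" using T D finD finite_subset[OF T(1)] by (simp add: card_Diff_subset)
  then obtain c where c: "D - T = {c}" by (auto simp: card_1_singleton_iff)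
  have Dabc: "D = {a, b, c}" "c \<noteq> a" "c \<noteq> b" using c ab T(1) by blast+
  define S where "S e = {i \<in> I. e \<in> A i}" for e
  have parity: "c \<in> A i \<longleftrightarrow> (a \<in> A i) \<noteq> (b \<in> A i)" if "i \<in> I" for i
  proof -
    have "A i \<inter> D = (if a \<in> A i then {a} else {}) \<union> ((if b \<in> A i then {b} else {}) \<union> (if c \<in> A i then {c} else {}))"
      using Dabc(1) by auto
    then have "card (A i \<inter> D) = of_bool (a \<in> A i) + (of_bool (b \<in> A i) + of_bool (c \<in> A i))"
      using Dabc ab(2) by (simp add: card_insert_if)
    then show ?thesis using ev[OF that] by (cases "a \<in> A i"; cases "b \<in> A i"; cases "c \<in> A i") simp_all
  qed
  have fin: "finite (S e)" for e using I by (simp add: S_def)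
  have "S c = sym_diff (S a) (S b)" using parity unfolding S_def by blast
  moreover have "card (sym_diff (S a) (S b)) + 2 * card (S a \<inter> S b) = card (S a) + card (S b)"
  proof -
    have "card (sym_diff (S a) (S b)) = card (S a - S b) + card (S b - S a)"
      using fin by (intro card_Un_disjoint) auto
    moreover have "card (S a) = card (S a - S b) + card (S a \<inter> S b)"
      using card_Diff_subset_Int[of "S a" "S b"] fin card_mono[OF fin, of "S a \<inter> S b" a] by simp
    moreover have "card (S b) = card (S b - S a) + card (S a \<inter> S b)"
      using card_Diff_subset_Int[of "S b" "S a"] fin card_mono[OF fin, of "S a \<inter> S b" b]
      by (simp add: Int_commute)
    ultimately show ?thesis by simp
  qed
  ultimately have "card (S a \<inter> S b) = 1"
    using two[of a] two[of b] two[of c] Dabc(1) unfolding S_def[symmetric] by simp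
  moreover have "{i \<in> I. A i \<inter> D = T} = S a \<inter> S b"
    using parity Dabc ab unfolding S_def by blast
  ultimately show ?thesis by simp
qed

text \<open>
  By \<open>trace_on_three_edges_unique\<close> every set of one cover that meets the cut has exactly one partner
  in the other cover with the same edges of the cut. Uniting partners and keeping all sets that miss
  the cut gives the cover.
\<close>

lemma even_double_cover_glue:
  assumes G: "multigraph G" and X: "X \<subseteq> verts G" and cut: "card (boundary G X) = 3"
    and x: "x \<in> X" and y: "y \<in> verts G - X"
    and cov_X: "even_double_cover (contract G X x)"
    and cov_Y: "even_double_cover (contract G (verts G - X) y)"
  shows "even_double_cover G"
proof -
  define Y where "Y = verts G - X"
  define D where "D = boundary G X"
  have DY: "D = boundary G Y" using boundary_complement[OF G] by (simp add: D_def Y_def)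
  have disj: "X \<inter> Y = {}" "y \<in> Y" and V: "verts G = X \<union> Y" using X y by (auto simp: Y_def)
  have VE: "ends G e \<subseteq> X \<union> Y" if "e \<in> edges G" for e
    using multigraphD(3)[OF G that] V by simp
  have D_iff: "e \<in> D \<longleftrightarrow> e \<in> edges G \<and> \<not> ends G e \<subseteq> X \<and> \<not> ends G e \<subseteq> Y" for e
    using VE[of e] disj(1) unfolding D_def boundary_def by blast
  obtain I :: "nat set" and A where I: "finite I"
    and A: "\<And>i. i \<in> I \<Longrightarrow> even_set (contract G X x) (A i)"
    and twoA: "\<And>e. e \<in> edges (contract G X x) \<Longrightarrow> card {i \<in> I. e \<in> A i} = 2"
    using cov_X unfolding even_double_cover_def by blast
  obtain I' :: "nat set" and B where I': "finite I'"
    and B: "\<And>j. j \<in> I' \<Longrightarrow> even_set (contract G Y y) (B j)"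
    and twoB: "\<And>e. e \<in> edges (contract G Y y) \<Longrightarrow> card {j \<in> I'. e \<in> B j} = 2"
    using cov_Y unfolding even_double_cover_def Y_def by blast
  have A_edges: "e \<in> edges G" "\<not> ends G e \<subseteq> X" if "i \<in> I" "e \<in> A i" for i e
    using A[OF that(1)] that(2) by (auto simp: even_set_def)
  have B_edges: "e \<in> edges G" "\<not> ends G e \<subseteq> Y" if "j \<in> I'" "e \<in> B j" for j e
    using B[OF that(1)] that(2) by (auto simp: even_set_def)
  have A_even: "even (deg_in G (A i) v)" if "i \<in> I" "v \<in> Y" for i v
  proof -
    have "v \<in> verts (contract G X x)" "v \<notin> X" using that(2) by (simp_all add: Y_def)
    then show ?thesis using A[OF that(1)] deg_in_contract_outside[OF x] unfolding even_set_def by metis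
  qed
  have B_even: "even (deg_in G (B j) v)" if "j \<in> I'" "v \<in> X" for j v
  proof -
    have "v \<in> verts (contract G Y y)" "v \<notin> Y" using that(2) X by (auto simp: Y_def)
    then show ?thesis using B[OF that(1)] deg_in_contract_outside[OF disj(2)] unfolding even_set_def by metis
  qed
  have A_trace: "even (card (A i \<inter> D))" if "i \<in> I" for i
    using A[OF that] deg_in_contract_new[OF x, of "A i" G] by (simp add: even_set_def D_def del: contract_simps(2,3))
  have B_trace: "even (card (B j \<inter> D))" if "j \<in> I'" for j
    using B[OF that] deg_in_contract_new[OF disj(2), of "B j" G] by (simp add: even_set_def DY del: contract_simps(2,3))
  have cardD: "card D = 3" "finite D" using cut finite_boundary[OF G] by (auto simp: D_def)
  have uniqA: "card {i \<in> I. A i \<inter> D = T} = 1" if "T \<subseteq> D" "card T = 2" for T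
    by (rule trace_on_three_edges_unique[OF I cardD(1) A_trace _ that]) (simp_all add: twoA D_iff)
  have uniqB: "card {j \<in> I'. B j \<inter> D = T} = 1" if "T \<subseteq> D" "card T = 2" for T
    by (rule trace_on_three_edges_unique[OF I' cardD(1) B_trace _ that]) (simp_all add: twoB D_iff)
  have size2: "card T = 2" if "T \<subseteq> D" "even (card T)" "T \<noteq> {}" for T
  proof -
    have "card T \<le> 3" using card_mono[OF cardD(2) that(1)] cardD(1) by simp
    moreover have "card T \<noteq> 0" using that(1,3) finite_subset[OF that(1) cardD(2)] by simp
    ultimately show ?thesis using that(2) by presburger
  qed
  have injA: "i = i'" if "i \<in> I" "i' \<in> I" "A i \<inter> D = A i' \<inter> D" "A i \<inter> D \<noteq> {}" for i i'
  proof -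
    have "card {k \<in> I. A k \<inter> D = A i \<inter> D} = 1"
      using uniqA[OF _ size2[OF _ A_trace[OF that(1)] that(4)]] by simp
    then obtain k where "{k \<in> I. A k \<inter> D = A i \<inter> D} = {k}" by (auto simp: card_1_singleton_iff)
    moreover have "i \<in> {k \<in> I. A k \<inter> D = A i \<inter> D}" "i' \<in> {k \<in> I. A k \<inter> D = A i \<inter> D}"
      using that by simp_all
    ultimately show ?thesis by (metis singletonD)
  qed
  have injB: "j = j'" if "j \<in> I'" "j' \<in> I'" "B j \<inter> D = B j' \<inter> D" "B j \<inter> D \<noteq> {}" for j j'
  proof -
    have "card {k \<in> I'. B k \<inter> D = B j \<inter> D} = 1"
      using uniqB[OF _ size2[OF _ B_trace[OF that(1)] that(4)]] by simp
    then obtain k where "{k \<in> I'. B k \<inter> D = B j \<inter> D} = {k}" by (auto simp: card_1_singleton_iff)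
    moreover have "j \<in> {k \<in> I'. B k \<inter> D = B j \<inter> D}" "j' \<in> {k \<in> I'. B k \<inter> D = B j \<inter> D}"
      using that by simp_all
    ultimately show ?thesis by (metis singletonD)
  qed
  have partnerA: "\<exists>j\<in>I'. B j \<inter> D = A i \<inter> D" if "i \<in> I" "A i \<inter> D \<noteq> {}" for i
  proof -
    have "card {j \<in> I'. B j \<inter> D = A i \<inter> D} = 1"
      using uniqB[OF _ size2[OF _ A_trace[OF that(1)] that(2)]] by simp
    then obtain j where "{j \<in> I'. B j \<inter> D = A i \<inter> D} = {j}" by (auto simp: card_1_singleton_iff)
    then show ?thesis by blast
  qed
  have partnerB: "\<exists>i\<in>I. A i \<inter> D = B j \<inter> D" if "j \<in> I'" "B j \<inter> D \<noteq> {}" for j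
  proof -
    have "card {i \<in> I. A i \<inter> D = B j \<inter> D} = 1"
      using uniqA[OF _ size2[OF _ B_trace[OF that(1)] that(2)]] by simp
    then obtain i where "{i \<in> I. A i \<inter> D = B j \<inter> D} = {i}" by (auto simp: card_1_singleton_iff)
    then show ?thesis by blast
  qed
  obtain m where m: "\<And>i. i \<in> I \<Longrightarrow> A i \<inter> D \<noteq> {} \<Longrightarrow> m i \<in> I' \<and> B (m i) \<inter> D = A i \<inter> D"
    using partnerA by metis
  define P where "P = {i \<in> I. A i \<inter> D \<noteq> {}}"
  define Q where "Q = {j \<in> I'. B j \<inter> D = {}}"
  have bij_m: "bij_betw m P (I' - Q)"
  proof (rule bij_betw_imageI)
    show "inj_on m P"
    proof (rule inj_onI)
      fix i i' assume "i \<in> P" "i' \<in> P" "m i = m i'"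
      then show "i = i'" using injA[of i i'] m[of i] m[of i'] by (simp add: P_def)
    qed
    show "m ` P = I' - Q"
    proof (intro equalityI subsetI)
      fix j assume "j \<in> m ` P"
      then obtain i where "i \<in> P" "j = m i" by auto
      then show "j \<in> I' - Q" using m[of i] by (simp add: P_def Q_def)
    next
      fix j assume "j \<in> I' - Q"
      then have j: "j \<in> I'" "B j \<inter> D \<noteq> {}" by (auto simp: Q_def)
      then obtain i where i: "i \<in> I" "A i \<inter> D = B j \<inter> D" using partnerB by blast
      then have "m i = j" using injB[of "m i" j] m[of i] j by simp
      then show "j \<in> m ` P" using i j(2) by (auto simp: P_def)
    qed
  qed
  \<comment> \<open>The united pairs are indexed by their first component, so the right summand contributes only
    sets missing the cut.\<close>
  define C where "C k = (case k of Inl i \<Rightarrow> A i \<union> (if i \<in> P then B (m i) else {}) | Inr j \<Rightarrow> B j)" for k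
  show ?thesis
  proof (rule even_double_coverI[of "Inl ` I \<union> Inr ` Q" G C])
    show "finite (Inl ` I \<union> Inr ` Q)" using I I' by (simp add: Q_def)
  next
    fix k assume "k \<in> Inl ` I \<union> Inr ` Q"
    then consider (paired) i where "k = Inl i" "i \<in> I" "i \<in> P"
      | (left) i where "k = Inl i" "i \<in> I" "i \<notin> P" | (right) j where "k = Inr j" "j \<in> Q" by blast
    then show "even_set G (C k)"
    proof cases
      case paired
      then have k: "C k = A i \<union> B (m i)" "m i \<in> I'" "B (m i) \<inter> D = A i \<inter> D"
        using m[of i] by (auto simp: C_def P_def)
      show ?thesis unfolding even_set_def
      proof (intro conjI ballI)
        show "C k \<subseteq> edges G" using k A_edges(1)[OF paired(2)] B_edges(1)[OF k(2)] by blast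
        fix v assume "v \<in> verts G"
        then consider "v \<in> Y" "v \<notin> X" | "v \<in> X" "v \<notin> Y" using V disj by blast
        then show "even (deg_in G (C k) v)"
        proof cases
          case 1
          have "{e \<in> C k. v \<in> ends G e} = {e \<in> A i. v \<in> ends G e}"
          proof -
            have "e \<in> A i" if "e \<in> B (m i)" "v \<in> ends G e" for e
              using B_edges[OF k(2) that(1)] that 1 k(3) D_iff[of e] by blast
            then show ?thesis using k(1) by blast
          qed
          then show ?thesis using A_even[OF paired(2) 1(1)] by (simp add: deg_in_def)
        next
          case 2
          have "{e \<in> C k. v \<in> ends G e} = {e \<in> B (m i). v \<in> ends G e}"
          proof -
            have "e \<in> B (m i)" if "e \<in> A i" "v \<in> ends G e" for e
              using A_edges[OF paired(2) that(1)] that 2 k(3) D_iff[of e] by blast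
            then show ?thesis using k(1) by blast
          qed
          then show ?thesis using B_even[OF k(2) 2(1)] by (simp add: deg_in_def)
        qed
      qed
    next
      case left
      then have k: "C k = A i" "A i \<inter> D = {}" by (auto simp: C_def P_def)
      show ?thesis unfolding even_set_def
      proof (intro conjI ballI)
        show "C k \<subseteq> edges G" using k(1) A_edges(1)[OF left(2)] by blast
        fix v assume "v \<in> verts G"
        then consider "v \<in> Y" | "v \<in> X" "v \<notin> Y" using V disj by blast
        then show "even (deg_in G (C k) v)"
        proof cases
          case 1
          then show ?thesis using A_even[OF left(2)] k(1) by simp
        next
          case 2
          have "e \<notin> A i" if "v \<in> ends G e" for e
            using A_edges[OF left(2), of e] that 2 k(2) D_iff[of e] by blast
          then have "{e \<in> C k. v \<in> ends G e} = {}" using k(1) by blast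
          then show ?thesis unfolding deg_in_def by (simp only: card.empty even_zero)
        qed
      qed
    next
      case right
      then have k: "C k = B j" "B j \<inter> D = {}" "j \<in> I'" by (auto simp: C_def Q_def)
      show ?thesis unfolding even_set_def
      proof (intro conjI ballI)
        show "C k \<subseteq> edges G" using k(1) B_edges(1)[OF k(3)] by blast
        fix v assume "v \<in> verts G"
        then consider "v \<in> X" | "v \<in> Y" "v \<notin> X" using V disj by blast
        then show "even (deg_in G (C k) v)"
        proof cases
          case 1
          then show ?thesis using B_even[OF k(3)] k(1) by simp
        next
          case 2
          have "e \<notin> B j" if "v \<in> ends G e" for e
            using B_edges[OF k(3), of e] that 2 k(2) D_iff[of e] by blast
          then have "{e \<in> C k. v \<in> ends G e} = {}" using k(1) by blast
          then show ?thesis unfolding deg_in_def by (simp only: card.empty even_zero)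
        qed
      qed
    qed
  next
    fix e assume e: "e \<in> edges G"
    show "card {k \<in> Inl ` I \<union> Inr ` Q. e \<in> C k} = 2"
    proof (cases "ends G e \<subseteq> X")
      case False
      have left: "e \<in> C (Inl i) \<longleftrightarrow> e \<in> A i" if "i \<in> I" for i
      proof (cases "i \<in> P")
        case True
        then have mi: "m i \<in> I'" "B (m i) \<inter> D = A i \<inter> D" using m[of i] by (auto simp: P_def)
        have "e \<in> A i" if "e \<in> B (m i)"
          using B_edges[OF mi(1) that] that mi(2) D_iff[of e] False by blast
        then show ?thesis using True by (auto simp: C_def)
      qed (simp add: C_def)
      have right: "e \<notin> C (Inr j)" if "j \<in> Q" for j
        using that B_edges[of j e] D_iff[of e] False by (auto simp: C_def Q_def)
      have "{k \<in> Inl ` I \<union> Inr ` Q. e \<in> C k} = Inl ` {i \<in> I. e \<in> A i}"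
        using left right by blast
      then show ?thesis using twoA[of e] e False by (simp add: card_image)
    next
      case True
      have notY: "\<not> ends G e \<subseteq> Y"
      proof -
        obtain u v where "ends G e = {u, v}" by (rule edge_endsE[OF G e])
        then show ?thesis using True disj(1) by blast
      qed
      have left: "e \<in> C (Inl i) \<longleftrightarrow> i \<in> P \<and> e \<in> B (m i)" if "i \<in> I" for i
        using A_edges(2)[OF that, of e] True by (auto simp: C_def)
      have "{k \<in> Inl ` I \<union> Inr ` Q. e \<in> C k} = Inl ` {i \<in> P. e \<in> B (m i)} \<union> Inr ` {j \<in> Q. e \<in> B j}"
        using left by (auto simp: C_def P_def)
      moreover have "card (Inl ` {i \<in> P. e \<in> B (m i)} \<union> Inr ` {j \<in> Q. e \<in> B j} :: (nat + nat) set)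
          = card {i \<in> P. e \<in> B (m i)} + card {j \<in> Q. e \<in> B j}"
        using I I' by (subst card_Un_disjoint) (auto simp: P_def Q_def card_image)
      moreover have "card {i \<in> P. e \<in> B (m i)} = card {j \<in> I' - Q. e \<in> B j}"
      proof (rule bij_betw_same_card)
        have "m ` {i \<in> P. e \<in> B (m i)} = {j \<in> m ` P. e \<in> B j}" by blast
        moreover have "inj_on m {i \<in> P. e \<in> B (m i)}"
          by (rule inj_on_subset[OF bij_betw_imp_inj_on[OF bij_m]]) blast
        ultimately show "bij_betw m {i \<in> P. e \<in> B (m i)} {j \<in> I' - Q. e \<in> B j}"
          by (simp add: bij_betw_def bij_betw_imp_surj_on[OF bij_m])
      qed
      moreover have "card {j \<in> I' - Q. e \<in> B j} + card {j \<in> Q. e \<in> B j} = card {j \<in> I'. e \<in> B j}"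
      proof -
        have "{j \<in> I'. e \<in> B j} = {j \<in> I' - Q. e \<in> B j} \<union> {j \<in> Q. e \<in> B j}" by (auto simp: Q_def)
        moreover have "finite {j \<in> I' - Q. e \<in> B j}" "finite {j \<in> Q. e \<in> B j}"
          using I' by (simp_all add: Q_def)
        moreover have "{j \<in> I' - Q. e \<in> B j} \<inter> {j \<in> Q. e \<in> B j} = {}" by blast
        ultimately show ?thesis by (metis card_Un_disjoint)
      qed
      moreover have "card {j \<in> I'. e \<in> B j} = 2" using twoB[of e] e notY by simp
      ultimately show ?thesis by simp
    qed
  qed
qed

text \<open>
  Taking the boundary is linear over the field with two elements, and the boundary of a single
  vertex consists of its incident edges.
\<close>

lemma boundary_remove_vertex:
  assumes "multigraph G" "x \<in> X"
  shows "boundary G (X - {x}) = sym_diff (boundary G X) (incident_edges G x)"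
proof (rule set_eqI)
  fix e
  show "e \<in> boundary G (X - {x}) \<longleftrightarrow> e \<in> sym_diff (boundary G X) (incident_edges G x)"
  proof (cases "e \<in> edges G")
    case True
    obtain u v where "ends G e = {u, v}" "u \<noteq> v" by (rule edge_endsE[OF assms(1) True])
    then show ?thesis using assms(2) True by (auto simp: boundary_def incident_edges_def)
  qed (simp add: boundary_def incident_edges_def)
qed

text \<open>
  Let an end \<open>x\<close> of an edge of the cut change sides. If both edges of the cut ended in \<open>x\<close>, then the
  third edge at \<open>x\<close> would be the only one leaving \<open>X - {x}\<close>.
\<close>

lemma three_cut_from_two_cut:
  assumes G: "multigraph G" "cubic G" "two_edge_connected G"
    and X: "X \<subseteq> verts G" "card X \<ge> 3" "card (verts G - X) \<ge> 2" and cut: "card (boundary G X) = 2"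
  obtains X' where "X' \<subseteq> verts G" "card X' \<ge> 2" "card (verts G - X') \<ge> 2" "card (boundary G X') = 3"
proof -
  have finX: "finite X" using X(2) card.infinite by fastforce
  have "boundary G X \<noteq> {}" using cut by auto
  then obtain e where e: "e \<in> boundary G X" by blast
  then obtain x where x: "x \<in> ends G e" "x \<in> X" by (auto simp: boundary_def)
  let ?D = "boundary G X" and ?I = "incident_edges G x"
  have I: "card ?I = 3" "finite ?I"
    using G(1,2) X(1) x(2) by (auto simp: regular_def degree_def incident_edges_def multigraph_def)
  have D: "finite ?D" by (rule finite_boundary[OF G(1)])
  have "e \<in> ?D \<inter> ?I" using e x(1) by (simp add: boundary_def incident_edges_def)
  then have "card (?D \<inter> ?I) \<noteq> 0" using D by auto
  have X': "X - {x} \<subseteq> verts G" "card (X - {x}) \<ge> 2" using X(1,2) x(2) finX by auto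
  have "card (sym_diff ?D ?I) = card (?D - ?I) + card (?I - ?D)"
    using D I(2) by (intro card_Un_disjoint) auto
  also have "card (?D - ?I) = card ?D - card (?D \<inter> ?I)" using D by (simp add: card_Diff_subset_Int)
  also have "card (?I - ?D) = card ?I - card (?D \<inter> ?I)"
    using I(2) by (simp add: card_Diff_subset_Int Int_commute)
  finally have bd: "card (boundary G (X - {x})) = (2 - card (?D \<inter> ?I)) + (3 - card (?D \<inter> ?I))"
    using boundary_remove_vertex[OF G(1) x(2)] cut I(1) by simp
  moreover have "card (?D \<inter> ?I) \<le> 2" using card_mono[of ?D "?D \<inter> ?I"] D cut by simp
  moreover have "2 \<le> card (boundary G (X - {x}))"
  proof -
    have "X - {x} \<noteq> {}" using X'(2) by (metis card.empty not_numeral_le_zero)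
    moreover have "X - {x} \<noteq> verts G" using x(2) X(1) by auto
    ultimately show ?thesis using G(3) X'(1) by (simp add: two_edge_connected_def)
  qed
  ultimately have "card (boundary G (X - {x})) = 3" using \<open>card (?D \<inter> ?I) \<noteq> 0\<close> by arith
  moreover have "card (verts G - (X - {x})) \<ge> 2"
    using X(3) card_mono[of "verts G - (X - {x})" "verts G - X"] multigraphD(1)[OF G(1)] by fastforce
  ultimately show thesis using that X' by blast
qed

text \<open>
  At either of the two vertices \<open>x\<close> of \<open>X\<close>, the edges of the cut at \<open>x\<close> and the parallel edges
  inside \<open>X\<close> add up to three. Adding both equations leaves two parallel edges.
\<close>

lemma two_vertex_side_of_two_cut:
  assumes G: "multigraph G" "cubic G" "two_edge_connected G"
    and X: "X \<subseteq> verts G" "card X = 2" "X \<noteq> verts G" and cut: "card (boundary G X) = 2"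
  shows "card {e \<in> edges G. ends G e = X} = 2"
    and "x \<in> X \<Longrightarrow> card {e \<in> boundary G X. x \<in> ends G e} = 1"
proof -
  let ?D = "boundary G X" and ?E = "{e \<in> edges G. ends G e = X}"
  have fin: "finite ?D" "finite ?E" using finite_boundary[OF G(1)] multigraphD(2)[OF G(1)] by auto
  have deg: "card {e \<in> ?D. x \<in> ends G e} + card ?E = 3" if x: "x \<in> X" for x
  proof -
    have "e \<in> ?D \<or> e \<in> ?E" if "e \<in> edges G" "x \<in> ends G e" for e
    proof (cases "ends G e \<subseteq> X")
      case True
      then show ?thesis
        using card_subset_eq[of X "ends G e"] X(2) multigraphD(4)[OF G(1) that(1)] that(1)
          card.infinite by fastforce
    next
      case False
      then show ?thesis using that x by (auto simp: boundary_def)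
    qed
    then have "incident_edges G x = {e \<in> ?D. x \<in> ends G e} \<union> ?E"
      using x by (auto simp: incident_edges_def boundary_def)
    moreover have "{e \<in> ?D. x \<in> ends G e} \<inter> ?E = {}" by (auto simp: boundary_def)
    moreover have "card (incident_edges G x) = 3"
      using G(2) X(1) x by (auto simp: regular_def degree_def)
    ultimately show ?thesis using fin by (simp add: card_Un_disjoint)
  qed
  obtain u v where uv: "X = {u, v}" "u \<noteq> v" using X(2) by (meson card_2_iff)
  have "?D = {e \<in> ?D. u \<in> ends G e} \<union> {e \<in> ?D. v \<in> ends G e}"
    unfolding boundary_def uv(1) by blast
  moreover have "{e \<in> ?D. u \<in> ends G e} \<inter> {e \<in> ?D. v \<in> ends G e} = {}"
  proof -
    have False if "e \<in> ?D" "u \<in> ends G e" "v \<in> ends G e" for e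
    proof -
      have eG: "e \<in> edges G" and notX: "\<not> ends G e \<subseteq> X" using that(1) by (auto simp: boundary_def)
      obtain a b where "ends G e = {a, b}" by (rule edge_endsE[OF G(1) eG])
      then show False using that(2,3) uv notX by auto
    qed
    then show ?thesis by blast
  qed
  ultimately have "card ?D = card {e \<in> ?D. u \<in> ends G e} + card {e \<in> ?D. v \<in> ends G e}"
    using fin(1) by (metis (no_types, lifting) card_Un_disjoint finite_Un)
  then have "card ?E = 2" using deg[of u] deg[of v] uv(1) cut by simp
  then show "card {e \<in> edges G. ends G e = X} = 2" .
  show "card {e \<in> boundary G X. x \<in> ends G e} = 1" if "x \<in> X" using deg[OF that] \<open>card ?E = 2\<close> by simp
qed

text \<open>
  The graph is a 4-cycle two opposite edges of which are doubled. It is covered by the two pairs of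
  parallel edges together with two 4-cycles.
\<close>

lemma even_double_cover_necklace:
  assumes G: "multigraph G" "cubic G" "two_edge_connected G"
    and X: "X \<subseteq> verts G" "card X = 2" "card (verts G - X) = 2" and cut: "card (boundary G X) = 2"
  shows "even_double_cover G"
proof -
  define Y where "Y = verts G - X"
  define D where "D = boundary G X"
  have DY: "D = boundary G Y" using boundary_complement[OF G(1)] by (simp add: D_def Y_def)
  have cardY: "card Y = 2" using X(3) by (simp add: Y_def)
  then have "X \<noteq> verts G" using Y_def by auto
  moreover have "X \<noteq> {}" using X(2) by auto
  then have "Y \<noteq> verts G" using X(1) by (auto simp: Y_def)
  ultimately have EX: "card {e \<in> edges G. ends G e = X} = 2"
    and EY: "card {e \<in> edges G. ends G e = Y} = 2"
    and DX1: "\<And>x. x \<in> X \<Longrightarrow> card {e \<in> D. x \<in> ends G e} = 1"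
    and DY1: "\<And>y. y \<in> Y \<Longrightarrow> card {e \<in> D. y \<in> ends G e} = 1"
    using two_vertex_side_of_two_cut[OF G X(1,2) _ cut] two_vertex_side_of_two_cut[OF G _ cardY, folded DY] cut
    by (auto simp: Y_def D_def)
  obtain p p' where p: "{e \<in> edges G. ends G e = X} = {p, p'}" "p \<noteq> p'" using EX by (meson card_2_iff)
  obtain q q' where q: "{e \<in> edges G. ends G e = Y} = {q, q'}" "q \<noteq> q'" using EY by (meson card_2_iff)
  have disj: "X \<inter> Y = {}" "X \<union> Y = verts G" using X(1) by (auto simp: Y_def)
  have XY: "X \<noteq> {}" "Y \<noteq> {}" using X(2) cardY by auto
  have ends: "ends G p = X" "ends G p' = X" "ends G q = Y" "ends G q' = Y"
    and E: "p \<in> edges G" "p' \<in> edges G" "q \<in> edges G" "q' \<in> edges G"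
    using p(1) q(1) by blast+
  have notD: "p \<notin> D" "p' \<notin> D" using ends by (auto simp: D_def boundary_def)
  have notD': "q \<notin> D" "q' \<notin> D" using ends by (auto simp: DY boundary_def)
  have neq: "p \<noteq> q" "p \<noteq> q'" "p' \<noteq> q" "p' \<noteq> q'" using ends disj XY by blast+
  have E_cases: "e \<in> D \<or> e \<in> {p, p', q, q'}" if e: "e \<in> edges G" for e
  proof -
    have fin: "finite X" "finite Y" using X(2) cardY card.infinite by fastforce+
    have "ends G e \<subseteq> X \<union> Y" using multigraphD(3)[OF G(1) e] disj(2) by simp
    then consider "e \<in> D" | "ends G e \<subseteq> X" | "ends G e \<subseteq> Y"
      using e by (auto simp: D_def boundary_def)
    then show ?thesis
    proof cases
      case 2
      then have "ends G e = X" using card_subset_eq[OF fin(1)] X(2) multigraphD(4)[OF G(1) e] by simp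
      then have "e \<in> {p, p'}" using p(1) e by blast
      then show ?thesis by blast
    next
      case 3
      then have "ends G e = Y" using card_subset_eq[OF fin(2)] cardY multigraphD(4)[OF G(1) e] by simp
      then have "e \<in> {q, q'}" using q(1) e by blast
      then show ?thesis by blast
    qed simp
  qed
  have finD: "finite D" using finite_boundary[OF G(1)] by (simp add: D_def)
  have degD: "deg_in G D v = 1" if "v \<in> verts G" for v
    using that DX1 DY1 disj(2) unfolding deg_in_def by blast
  have in_XY: "v \<in> X \<longleftrightarrow> v \<notin> Y" if "v \<in> verts G" for v using that disj by blast
  define A where "A i = [{p, p'}, {q, q'}, insert p (insert q D), insert p' (insert q' D)] ! i" for i
  show ?thesis
  proof (rule even_double_coverI[of "{0, 1, 2, 3 :: nat}" G A])
    fix i :: nat assume "i \<in> {0, 1, 2, 3}"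
    moreover have "even_set G {p, p'}" "even_set G {q, q'}"
      using E p(2) q(2) ends by (auto simp: even_set_def deg_in_insert)
    moreover have "even_set G (insert p (insert q D))" "even_set G (insert p' (insert q' D))"
      using E ends in_XY degD finD notD notD' neq
      by (auto simp: even_set_def deg_in_insert) (auto simp: D_def boundary_def)
    ultimately show "even_set G (A i)" by (auto simp: A_def)
  next
    fix e assume e: "e \<in> edges G"
    have "{i \<in> {0, 1, 2, 3 :: nat}. e \<in> A i} =
      (if e \<in> D then {2, 3} else if e = p then {0, 2} else if e = p' then {0, 3}
       else if e = q then {1, 2} else {1, 3})"
      using E_cases[OF e] notD notD' neq p(2) q(2) by (auto simp: A_def)
    then show "card {i \<in> {0, 1, 2, 3}. e \<in> A i} = 2" by simp
  qed simp
qed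

text \<open>
  Induction on the number of vertices; both sides of the cut need two vertices for
  the contractions to be smaller.
\<close>

theorem even_double_cover_if_cyclically_4_edge_connected:
  fixes G :: "('v, 'e) mgraph"
  assumes base: "\<And>H :: ('v, 'e) mgraph. multigraph H \<Longrightarrow> cubic H \<Longrightarrow>
      cyclically_edge_connected 4 H \<Longrightarrow> even_double_cover H"
    and "multigraph G" "cubic G" "two_edge_connected G" "verts G \<noteq> {}"
  shows "even_double_cover G"
  using assms(2-5)
proof (induction "card (verts G)" arbitrary: G rule: less_induct)
  case less
  note G = less.prems(1-3)
  have finV: "finite (verts G)" using multigraphD(1)[OF G(1)] .
  have three_cut: "even_double_cover G"
    if X: "X \<subseteq> verts G" "card X \<ge> 2" "card (verts G - X) \<ge> 2" "card (boundary G X) = 3" for X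
  proof -
    have contracted: "even_double_cover (contract G Z z)"
      if Z: "Z \<subseteq> verts G" "card Z \<ge> 2" "card (boundary G Z) = 3" "z \<in> Z" for Z z
    proof (rule less.hyps)
      have finZ: "finite Z" using Z(1) finV finite_subset by auto
      have "card (insert z (verts G - Z)) = Suc (card (verts G) - card Z)"
        using Z(4) finV finZ Z(1) by (simp add: card_Diff_subset)
      moreover have "card Z \<le> card (verts G)" using card_mono[OF finV Z(1)] .
      ultimately show "card (verts (contract G Z z)) < card (verts G)" using Z(2) by simp
    qed (use G Z multigraph_contract cubic_contract two_edge_connected_contract in \<open>auto simp del: contract_simps(2,3)\<close>)
    have "X \<noteq> {}" "verts G - X \<noteq> {}" using X(2,3) by fastforce+
    then obtain x y where xy: "x \<in> X" "y \<in> verts G - X" by blast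
    show ?thesis
      by (rule even_double_cover_glue[OF G(1) X(1,4) xy contracted[OF X(1,2,4) xy(1)]])
        (rule contracted[OF _ X(3) _ xy(2)], use X(4) boundary_complement[OF G(1)] in auto)
  qed
  show ?case
  proof (cases "cyclically_edge_connected 4 G")
    case True
    then show ?thesis using base G by blast
  next
    case False
    obtain X where X: "X \<subseteq> verts G" "card X \<ge> 2" "card (verts G - X) \<ge> 2" "card (boundary G X) \<le> 3"
      using small_cut_if_not_cyclically_4_edge_connected[OF G(1) _ False]
        connected_if_two_edge_connected[OF G(1) less.prems(4) G(3)] by blast
    have "X \<noteq> {}" "X \<noteq> verts G" using X(2,3) by fastforce+
    then have "card (boundary G X) \<ge> 2" using G(3) X(1) by (simp add: two_edge_connected_def)
    then consider "card (boundary G X) = 3" | "card (boundary G X) = 2" "card X = 2" "card (verts G - X) = 2"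
      | "card (boundary G X) = 2" "card X \<ge> 3" | "card (boundary G X) = 2" "card (verts G - X) \<ge> 3"
      using X by linarith
    then show ?thesis
    proof cases
      case 1
      then show ?thesis using three_cut X by blast
    next
      case 2
      then show ?thesis using even_double_cover_necklace[OF G X(1)] by blast
    next
      case 3
      then show ?thesis using three_cut_from_two_cut[OF G X(1) _ X(3)] three_cut by metis
    next
      case 4
      have "verts G - (verts G - X) = X" using X(1) by blast
      then show ?thesis
        using three_cut_from_two_cut[OF G, of "verts G - X"] 4 X(2) boundary_complement[OF G(1)] three_cut
        by (metis Diff_subset)
    qed
  qed
qed

section \<open>Colorings of Kotzig-frames\<close>

text \<open>
  The edges of a walk from \<open>u\<close> to \<open>v\<close>, each counted modulo 2.
\<close>

lemma even_set_joining_two_vertices: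
  assumes "finite B" "\<And>e. e \<in> B \<Longrightarrow> card (ends G e) = 2"
    and "(u, v) \<in> (adjacency (spanning G B))\<^sup>*"
  shows "\<exists>J\<subseteq>B. \<forall>x. odd (deg_in G J x) \<longleftrightarrow> (x = u) \<noteq> (x = v)"
  using assms(3)
proof (induction rule: rtrancl_induct)
  case base
  show ?case by (intro exI[of _ "{}"]) simp
next
  case (step y z)
  then obtain J where J: "J \<subseteq> B" "\<And>x. odd (deg_in G J x) \<longleftrightarrow> (x = u) \<noteq> (x = y)" by auto
  obtain e where e: "e \<in> B" "ends G e = {y, z}" using step.hyps by (auto simp: adjacency_def)
  have "y \<noteq> z" using assms(2)[OF e(1)] e(2) by auto
  moreover have "deg_in G {e} x = (if x = y \<or> x = z then 1 else 0)" for x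
    using deg_in_insert[of "{}" e G x] e(2) by simp
  moreover have "finite J" using J(1) assms(1) finite_subset by blast
  ultimately have "odd (deg_in G (sym_diff J {e}) x) \<longleftrightarrow> (x = u) \<noteq> (x = z)" for x
    using J(2)[of x] odd_deg_in_sym_diff[of J "{e}" G x] by auto
  moreover have "sym_diff J {e} \<subseteq> B" using J(1) e(1) by auto
  ultimately show ?case by blast
qed

text \<open>
  The vertices of \<open>T\<close> are paired up within the classes of \<open>p\<close>, and each pair is joined by a walk.
  Symmetric differences keep the parities right even where the walks overlap.
\<close>

lemma t_join:
  assumes "finite B" "\<And>e. e \<in> B \<Longrightarrow> card (ends G e) = 2"
    and "finite T" "\<And>j. even (card {x \<in> T. p x = j})"
    and "\<And>x y. x \<in> T \<Longrightarrow> y \<in> T \<Longrightarrow> p x = p y \<Longrightarrow> (x, y) \<in> (adjacency (spanning G B))\<^sup>*"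
  shows "\<exists>J\<subseteq>B. \<forall>x. odd (deg_in G J x) \<longleftrightarrow> x \<in> T"
  using assms(3-5)
proof (induction T rule: finite_psubset_induct)
  case (psubset T)
  show ?case
  proof (cases "T = {}")
    case True
    then show ?thesis by (intro exI[of _ "{}"]) simp
  next
    case False
    then obtain x where x: "x \<in> T" by auto
    have "finite {z \<in> T. p z = p x}" "x \<in> {z \<in> T. p z = p x}" using x psubset.hyps by auto
    then have "{z \<in> T. p z = p x} \<noteq> {x}" using psubset.prems(1)[of "p x"] by auto
    then obtain y where y: "y \<in> T" "p y = p x" "y \<noteq> x" using x by auto
    have "even (card {z \<in> T - {x, y}. p z = j})" for j
    proof (cases "j = p x")
      case True
      then have "{z \<in> T - {x, y}. p z = j} = {z \<in> T. p z = j} - {x, y}" by auto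
      moreover have "{x, y} \<subseteq> {z \<in> T. p z = j}" using x y True by auto
      moreover have "finite {z \<in> T. p z = j}" using psubset.hyps by auto
      ultimately have "card {z \<in> T - {x, y}. p z = j} = card {z \<in> T. p z = j} - card {x, y}"
        by (metis card_Diff_subset finite_subset)
      then show ?thesis using psubset.prems(1)[of j] y by simp
    next
      case False
      then have "{z \<in> T - {x, y}. p z = j} = {z \<in> T. p z = j}" using y by auto
      then show ?thesis using psubset.prems(1) by metis
    qed
    moreover have "T - {x, y} \<subset> T" using x by auto
    ultimately obtain J where J: "J \<subseteq> B" "\<And>z. odd (deg_in G J z) \<longleftrightarrow> z \<in> T - {x, y}"
      using psubset.IH[of "T - {x, y}"] psubset.prems(2) by auto
    obtain J' where J': "J' \<subseteq> B" "\<And>z. odd (deg_in G J' z) \<longleftrightarrow> (z = x) \<noteq> (z = y)"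
      using even_set_joining_two_vertices[OF assms(1,2) psubset.prems(2)[OF x y(1)]] y(2) by metis
    have "odd (deg_in G (sym_diff J J') z) \<longleftrightarrow> z \<in> T" for z
      using J J' odd_deg_in_sym_diff[of J J' G z] assms(1) x y finite_subset[of _ B] by auto
    moreover have "sym_diff J J' \<subseteq> B" using J J' by auto
    ultimately show ?thesis by blast
  qed
qed

definition avoiding :: "('v, 'e) mgraph \<Rightarrow> ('e \<Rightarrow> nat) \<Rightarrow> nat \<Rightarrow> 'e set" where
  "avoiding F \<kappa> c = {e \<in> edges F. \<kappa> e \<noteq> c}"

text \<open>
  The colors of a frame serve to select subgraphs: dropping one color leaves, within each component,
  an even graph that is connected up to isolated vertices. It may be empty, as happens
  for one of the colors of a cycle component.
\<close>

definition frame_coloring :: "('v, 'e) mgraph \<Rightarrow> ('e \<Rightarrow> nat) \<Rightarrow> bool" where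
  "frame_coloring F \<kappa> \<longleftrightarrow> (\<forall>e\<in>edges F. \<kappa> e \<in> {1, 2, 3}) \<and>
     (\<forall>x\<in>verts F. \<exists>e\<in>edges F. x \<in> ends F e) \<and>
     (\<forall>c\<in>{1, 2, 3}. \<forall>x\<in>verts F. even (deg_in F (avoiding F \<kappa> c) x)) \<and>
     (\<forall>c\<in>{1, 2, 3}. \<forall>e\<in>avoiding F \<kappa> c. \<forall>e'\<in>avoiding F \<kappa> c. \<forall>x\<in>ends F e. \<forall>y\<in>ends F e'.
        (x, y) \<in> (adjacency F)\<^sup>* \<longrightarrow> (x, y) \<in> (adjacency (spanning F (avoiding F \<kappa> c)))\<^sup>*)"

text \<open>
  All edges get the same color, so every set \<open>avoiding\<close> one color is the whole cycle or empty.
\<close>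

lemma frame_coloring_cycle:
  assumes "is_cycle C"
  shows "frame_coloring C (\<lambda>_. 1)"
proof -
  have m: "multigraph C" and deg: "\<And>x. x \<in> verts C \<Longrightarrow> deg_in C (edges C) x = 2"
    using assms by (auto simp: is_cycle_def regular_def degree_eq)
  have av: "avoiding C (\<lambda>_. 1) c = (if c = 1 then {} else edges C)" for c
    by (auto simp: avoiding_def)
  have adj: "adjacency (spanning C (edges C)) = adjacency C" by (simp add: adjacency_def)
  have "\<exists>e\<in>edges C. x \<in> ends C e" if "x \<in> verts C" for x
  proof -
    have "{e \<in> edges C. x \<in> ends C e} \<noteq> {}"
      using deg[OF that] unfolding deg_in_def by (metis card.empty zero_neq_numeral)
    then show ?thesis by blast
  qed
  then show ?thesis unfolding frame_coloring_def av using deg adj by simp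
qed

text \<open>
  The edges of two colors form an even set. A component of it is a cycle carrying at most two colors,
  hence hamiltonian, so it is the only one.
\<close>

lemma kotzig_graph_coloring:
  assumes "kotzig_graph K"
  obtains \<kappa> where "\<And>e. e \<in> edges K \<Longrightarrow> \<kappa> e \<in> {1, 2, 3 :: nat}"
    and "\<And>c v. c \<in> {1, 2, 3} \<Longrightarrow> v \<in> verts K \<Longrightarrow> deg_in K (avoiding K \<kappa> c) v = 2"
    and "\<And>c u v. c \<in> {1, 2, 3} \<Longrightarrow> u \<in> verts K \<Longrightarrow> v \<in> verts K \<Longrightarrow>
           (u, v) \<in> (adjacency (spanning K (avoiding K \<kappa> c)))\<^sup>*"
proof -
  obtain \<kappa> where K: "multigraph K" "cubic K" and col: "edge_3_coloring K \<kappa>" "proper_edge_coloring K \<kappa>"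
    and ham: "\<And>C. cycle_of K C \<Longrightarrow> card (\<kappa> ` edges C) \<le> 2 \<Longrightarrow> hamiltonian_cycle K C"
    using assms by (auto simp: kotzig_graph_def)
  have range: "\<kappa> e \<in> {1, 2, 3}" if "e \<in> edges K" for e
    using col(1) that by (simp add: edge_3_coloring_def)
  have two: "deg_in K (avoiding K \<kappa> c) v = 2" if c: "c \<in> {1, 2, 3}" and v: "v \<in> verts K" for c v
  proof -
    let ?I = "incident_edges K v"
    have inj: "inj_on \<kappa> ?I"
      using col(2) unfolding proper_edge_coloring_def inj_on_def incident_edges_def by blast
    have "card ?I = 3" using K(2) v by (simp add: regular_def degree_def)
    then have "card (\<kappa> ` ?I) = card {1, 2, 3 :: nat}" using card_image[OF inj] by simp
    moreover have "\<kappa> ` ?I \<subseteq> {1, 2, 3}" using range by (auto simp: incident_edges_def)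
    ultimately have "\<kappa> ` ?I = {1, 2, 3}" by (intro card_subset_eq) auto
    then have "\<kappa> ` {e \<in> ?I. \<kappa> e \<noteq> c} = {1, 2, 3} - {c}" by blast
    moreover have "card ({1, 2, 3} - {c}) = 2" using c by auto
    moreover have "card (\<kappa> ` {e \<in> ?I. \<kappa> e \<noteq> c}) = card {e \<in> ?I. \<kappa> e \<noteq> c}"
      using inj by (intro card_image) (auto simp: inj_on_def)
    moreover have "{e \<in> ?I. \<kappa> e \<noteq> c} = {e \<in> avoiding K \<kappa> c. v \<in> ends K e}"
      by (auto simp: incident_edges_def avoiding_def)
    ultimately show ?thesis by (simp add: deg_in_def)
  qed
  have "(u, v) \<in> (adjacency (spanning K (avoiding K \<kappa> c)))\<^sup>*"
    if c: "c \<in> {1, 2, 3}" and uv: "u \<in> verts K" "v \<in> verts K" for c u v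
  proof -
    let ?B = "avoiding K \<kappa> c"
    have "even_set K ?B" using two[OF c] by (auto simp: even_set_def avoiding_def)
    moreover have "{e \<in> ?B. u \<in> ends K e} \<noteq> {}"
      using two[OF c uv(1)] unfolding deg_in_def by (metis card.empty zero_neq_numeral)
    then obtain e where "e \<in> ?B" "u \<in> ends K e" by blast
    ultimately have cyc: "cycle_of K (component_at (spanning K ?B) u)"
      using component_at_even_set_cycle[OF K] uv by blast
    have "\<kappa> ` edges (component_at (spanning K ?B) u) \<subseteq> {1, 2, 3} - {c}"
      using range by (auto simp: avoiding_def)
    then have "card (\<kappa> ` edges (component_at (spanning K ?B) u)) \<le> card ({1, 2, 3} - {c})"
      by (intro card_mono) auto
    also have "\<dots> = 2" using c by auto
    finally show ?thesis using ham[OF cyc] uv(2) by (auto simp: hamiltonian_cycle_def)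
  qed
  then show thesis using that range two by blast
qed

lemma path_in_Cons:
  assumes "path_in G vs (e # es)"
  obtains v ws where "vs = v # ws" "v \<notin> set ws" "ws \<noteq> []" "ends G e = {v, hd ws}" "path_in G ws es"
proof -
  have p: "length vs = Suc (Suc (length es))" "distinct vs" "set vs \<subseteq> verts G"
    "e \<in> edges G" "set es \<subseteq> edges G"
    "\<And>i. i < Suc (length es) \<Longrightarrow> ends G ((e # es) ! i) = {vs ! i, vs ! Suc i}"
    using assms by (auto simp: path_in_def)
  obtain v w us where vs: "vs = v # w # us" using p(1) by (metis length_Suc_conv)
  have "path_in G (w # us) es"
    using p vs p(6)[of "Suc i" for i] by (auto simp: path_in_def)
  moreover have "ends G e = {v, w}" using p(6)[of 0] vs by simp
  ultimately show thesis using that[of v "w # us"] p(2) vs by auto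
qed

lemma path_in_ends:
  assumes "path_in G vs es" "e \<in> set es"
  shows "ends G e \<subseteq> set vs"
proof -
  obtain i where i: "i < length es" "es ! i = e" using assms(2) by (auto simp: in_set_conv_nth)
  then have "ends G e = {vs ! i, vs ! Suc i}" "Suc i < length vs"
    using assms(1) by (auto simp: path_in_def)
  then show ?thesis by simp
qed

text \<open>
  The inner vertices of a path have degree 2 on it. A path without edges has none of odd degree.
\<close>

lemma odd_deg_in_path:
  assumes "path_in G vs es"
  shows "odd (deg_in G (set es) x) \<longleftrightarrow> es \<noteq> [] \<and> (x = hd vs \<or> x = last vs)"
  using assms
proof (induction es arbitrary: vs)
  case Nil
  then show ?case by simp
next
  case (Cons e es)
  obtain v ws where vs: "vs = v # ws" "v \<notin> set ws" "ws \<noteq> []" "ends G e = {v, hd ws}" "path_in G ws es"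
    using path_in_Cons[OF Cons.prems] by metis
  have "e \<notin> set es" using path_in_ends[OF vs(5)] vs(2,4) by auto
  then have deg: "deg_in G (set (e # es)) x = deg_in G (set es) x + (if x = v \<or> x = hd ws then 1 else 0)"
    using deg_in_insert[of "set es" e G x] vs(4) by simp
  have hdw: "hd ws \<noteq> v" "last ws \<noteq> v" using vs(2,3) by auto
  have one: "es = [] \<longleftrightarrow> hd ws = last ws"
  proof
    assume "es = []"
    then have "length ws = 1" using vs(5) by (simp add: path_in_def)
    then show "hd ws = last ws" by (auto simp: length_Suc_conv)
  next
    assume eq: "hd ws = last ws"
    show "es = []"
    proof (rule ccontr)
      assume "es \<noteq> []"
      then obtain w u us where "ws = w # u # us"
        using vs(5) by (cases es) (auto simp: path_in_def length_Suc_conv)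
      then show False using eq vs(5) by (auto simp: path_in_def split: if_splits)
    qed
  qed
  show ?case using deg Cons.IH[OF vs(5)] hdw vs(1,3) one by auto
qed

lemma path_in_reach:
  assumes "path_in G vs es" "x \<in> set vs"
  shows "(hd vs, x) \<in> (adjacency (spanning G (set es)))\<^sup>*"
  using assms
proof (induction es arbitrary: vs)
  case Nil
  then have "length vs = 1" by (simp add: path_in_def)
  then show ?case using Nil by (auto simp: length_Suc_conv)
next
  case (Cons e es)
  obtain v ws where vs: "vs = v # ws" "ends G e = {v, hd ws}" "path_in G ws es"
    using path_in_Cons[OF Cons.prems(1)] by metis
  show ?case
  proof (cases "x \<in> set ws")
    case True
    have "(adjacency (spanning G (set es)))\<^sup>* \<subseteq> (adjacency (spanning G (set (e # es))))\<^sup>*"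
      by (intro rtrancl_mono adjacency_mono) auto
    then have "(hd ws, x) \<in> (adjacency (spanning G (set (e # es))))\<^sup>*"
      using Cons.IH[OF vs(3) True] by auto
    moreover have "(v, hd ws) \<in> adjacency (spanning G (set (e # es)))"
      using vs(2) by (intro adjacencyI[of e]) auto
    ultimately show ?thesis using vs(1) by (auto intro: converse_rtrancl_into_rtrancl)
  next
    case False
    then show ?thesis using Cons.prems(2) vs(1) by simp
  qed
qed

lemma path_in_vertex_on_edge:
  assumes "path_in G vs es" "x \<in> set vs" "es \<noteq> []"
  shows "\<exists>e\<in>set es. x \<in> ends G e"
proof -
  obtain i where i: "i < length vs" "vs ! i = x" using assms(2) by (auto simp: in_set_conv_nth)
  have p: "length vs = Suc (length es)"
    "\<And>i. i < length es \<Longrightarrow> ends G (es ! i) = {vs ! i, vs ! Suc i}"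
    using assms(1) by (auto simp: path_in_def)
  show ?thesis
  proof (cases "i < length es")
    case True
    then show ?thesis using p(2)[of i] i by (auto intro!: bexI[of _ "es ! i"])
  next
    case False
    then have "i = length es" "0 < length es" using i p assms(3) by auto
    then show ?thesis using p(2)[of "i - 1"] i by (auto intro!: bexI[of _ "es ! (i - 1)"])
  qed
qed

lemma deg_in_UN:
  assumes "finite B" "\<And>b. b \<in> B \<Longrightarrow> finite (E b)"
    and "\<And>b b'. b \<in> B \<Longrightarrow> b' \<in> B \<Longrightarrow> b \<noteq> b' \<Longrightarrow> E b \<inter> E b' = {}"
  shows "deg_in G (\<Union>b\<in>B. E b) x = (\<Sum>b\<in>B. deg_in G (E b) x)"
proof -
  have "{e \<in> (\<Union>b\<in>B. E b). x \<in> ends G e} = (\<Union>b\<in>B. {e \<in> E b. x \<in> ends G e})" by auto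
  moreover have "card \<dots> = (\<Sum>b\<in>B. card {e \<in> E b. x \<in> ends G e})"
    using assms by (intro card_UN_disjoint) auto
  ultimately show ?thesis by (simp add: deg_in_def)
qed

text \<open>
  Each edge inherits the color of the edge of \<open>K\<close> whose path contains it. Modulo 2 only the ends of
  these paths count, so the parities at the branch vertices are those in \<open>K\<close>, and walks in \<open>K\<close> lift
  to \<open>C\<close>.
\<close>

lemma frame_coloring_subdivision:
  fixes C :: "('v, 'e) mgraph" and K :: "('w, 'f) mgraph"
  assumes C: "multigraph C" and "kotzig_graph K" and "subdivision_of C K"
  shows "\<exists>\<kappa>. frame_coloring C \<kappa>"
proof -
  obtain \<phi> vs es where S: "inj_on \<phi> (verts K) \<and>
     (\<forall>e\<in>edges K. path_in C (vs e) (es e) \<and>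
        {hd (vs e), last (vs e)} = \<phi> ` ends K e \<and>
        set (vs e) \<inter> \<phi> ` verts K = \<phi> ` ends K e) \<and>
     (\<forall>e\<in>edges K. \<forall>e'\<in>edges K. e \<noteq> e' \<longrightarrow>
        set (vs e) \<inter> set (vs e') \<subseteq> \<phi> ` verts K \<and> set (es e) \<inter> set (es e') = {}) \<and>
     verts C = \<phi> ` verts K \<union> (\<Union>e\<in>edges K. set (vs e)) \<and>
     edges C = (\<Union>e\<in>edges K. set (es e)) \<and>
     (\<exists>e\<in>edges K. length (es e) \<ge> 2)"
    using assms(3) unfolding subdivision_of_def by (elim exE)
  have inj: "inj_on \<phi> (verts K)" using S by (elim conjE)
  have path: "path_in C (vs e) (es e)" if "e \<in> edges K" for e using S that by simp
  have pends: "{hd (vs e), last (vs e)} = \<phi> ` ends K e" if "e \<in> edges K" for e using S that by simp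
  have disj: "set (es e) \<inter> set (es e') = {}" if "e \<in> edges K" "e' \<in> edges K" "e \<noteq> e'" for e e'
    using S that by simp
  have verts_C: "verts C = \<phi> ` verts K \<union> (\<Union>e\<in>edges K. set (vs e))" using S by (elim conjE)
  have edges_C: "edges C = (\<Union>e\<in>edges K. set (es e))" using S by (elim conjE)
  have K: "multigraph K" "cubic K" using assms(2) by (auto simp: kotzig_graph_def)
  obtain \<kappa> where range: "\<And>e. e \<in> edges K \<Longrightarrow> \<kappa> e \<in> {1, 2, 3 :: nat}"
    and two: "\<And>c v. c \<in> {1, 2, 3} \<Longrightarrow> v \<in> verts K \<Longrightarrow> deg_in K (avoiding K \<kappa> c) v = 2"
    and conn: "\<And>c u v. c \<in> {1, 2, 3} \<Longrightarrow> u \<in> verts K \<Longrightarrow> v \<in> verts K \<Longrightarrow>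
           (u, v) \<in> (adjacency (spanning K (avoiding K \<kappa> c)))\<^sup>*"
    using kotzig_graph_coloring[OF assms(2)] by metis
  have nonempty: "es e \<noteq> []" if e: "e \<in> edges K" for e
  proof
    assume "es e = []"
    then have "length (vs e) = 1" using path[OF e] by (simp add: path_in_def)
    then have "card {hd (vs e), last (vs e)} = 1" by (auto simp: length_Suc_conv)
    moreover have "card (\<phi> ` ends K e) = 2"
      using multigraphD(3,4)[OF K(1) e] inj by (metis card_image inj_on_subset)
    ultimately show False using pends[OF e] by simp
  qed
  define own where "own a = (SOME e. e \<in> edges K \<and> a \<in> set (es e))" for a
  have own: "own a = e" if "e \<in> edges K" "a \<in> set (es e)" for a e
  proof -
    have "own a \<in> edges K \<and> a \<in> set (es (own a))"
      unfolding own_def by (rule someI[of _ e]) (use that in simp)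
    then show ?thesis using disj[of e "own a"] that by blast
  qed
  define \<mu> where "\<mu> a = \<kappa> (own a)" for a
  have lam: "\<mu> a = \<kappa> e" if "e \<in> edges K" "a \<in> set (es e)" for a e
    using own[OF that] by (simp add: \<mu>_def)
  have av: "avoiding C \<mu> c = (\<Union>e\<in>avoiding K \<kappa> c. set (es e))" for c
    using lam by (auto simp: avoiding_def edges_C)
  have "\<exists>a\<in>edges C. x \<in> ends C a" if x: "x \<in> verts C" for x
  proof -
    have "\<exists>e\<in>edges K. x \<in> set (vs e)"
    proof (cases "x \<in> \<phi> ` verts K")
      case True
      then obtain k where k: "k \<in> verts K" "x = \<phi> k" by auto
      have "{e \<in> edges K. k \<in> ends K e} \<noteq> {}"
        using K(2) k(1) unfolding regular_def degree_eq deg_in_def by (metis card.empty zero_neq_numeral)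
      then obtain e where e: "e \<in> edges K" "k \<in> ends K e" by auto
      then have "x \<in> {hd (vs e), last (vs e)}" using pends k(2) by blast
      moreover have "vs e \<noteq> []" using path[OF e(1)] by (auto simp: path_in_def)
      ultimately have "x \<in> set (vs e)" by (metis hd_in_set insertE last_in_set singletonD)
      then show ?thesis using e(1) by blast
    qed (use x verts_C in auto)
    then obtain e where e: "e \<in> edges K" "x \<in> set (vs e)" by auto
    show ?thesis
      using path_in_vertex_on_edge[OF path[OF e(1)] e(2) nonempty[OF e(1)]] e(1) edges_C by auto
  qed
  moreover have "even (deg_in C (avoiding C \<mu> c) x)" if c: "c \<in> {1, 2, 3}" for c x
  proof -
    let ?B = "avoiding K \<kappa> c"
    have B: "finite ?B" "?B \<subseteq> edges K" using multigraphD(2)[OF K(1)] by (auto simp: avoiding_def)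
    have "deg_in C (avoiding C \<mu> c) x = (\<Sum>e\<in>?B. deg_in C (set (es e)) x)"
      unfolding av using B disj by (intro deg_in_UN) auto
    moreover have "{e \<in> ?B. odd (deg_in C (set (es e)) x)} = {e \<in> ?B. x \<in> \<phi> ` ends K e}"
      using odd_deg_in_path[OF path] nonempty pends B by blast
    moreover have "even (card {e \<in> ?B. x \<in> \<phi> ` ends K e})"
    proof (cases "x \<in> \<phi> ` verts K")
      case True
      then obtain k where k: "k \<in> verts K" "x = \<phi> k" by auto
      have "x \<in> \<phi> ` ends K e \<longleftrightarrow> k \<in> ends K e" if "e \<in> ?B" for e
        using inj_on_image_mem_iff[OF inj k(1), of "ends K e"] multigraphD(3)[OF K(1), of e] that B k(2) by auto
      then have "{e \<in> ?B. x \<in> \<phi> ` ends K e} = {e \<in> ?B. k \<in> ends K e}" by auto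
      then show ?thesis using two[OF c k(1)] by (simp add: deg_in_def)
    next
      case False
      then have "{e \<in> ?B. x \<in> \<phi> ` ends K e} = {}" using multigraphD(3)[OF K(1)] B by blast
      then show ?thesis by (simp only: card.empty even_zero)
    qed
    ultimately show ?thesis by (simp only: even_sum_iff[OF B(1)])
  qed
  moreover have "(x, y) \<in> (adjacency (spanning C (avoiding C \<mu> c)))\<^sup>*"
    if c: "c \<in> {1, 2, 3}" and a: "a \<in> avoiding C \<mu> c" "x \<in> ends C a"
      and b: "b \<in> avoiding C \<mu> c" "y \<in> ends C b" for c a b x y
  proof -
    let ?B = "avoiding K \<kappa> c" and ?R = "(adjacency (spanning C (avoiding C \<mu> c)))\<^sup>*"
    have BK: "?B \<subseteq> edges K" by (auto simp: avoiding_def)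
    have along: "(hd (vs e), z) \<in> ?R" if e: "e \<in> ?B" and z: "z \<in> set (vs e)" for e z
    proof -
      have "(adjacency (spanning C (set (es e))))\<^sup>* \<subseteq> ?R"
        using e av by (intro rtrancl_mono adjacency_mono) auto
      then show ?thesis using path_in_reach[OF path z] e BK by auto
    qed
    have step: "(\<phi> k, \<phi> k') \<in> ?R" if kk: "(k, k') \<in> adjacency (spanning K ?B)" for k k'
    proof -
      obtain e where e: "e \<in> ?B" "ends K e = {k, k'}" using kk by (auto simp: adjacency_def)
      then have "{hd (vs e), last (vs e)} = {\<phi> k, \<phi> k'}" using pends[of e] BK by (simp add: subset_eq)
      moreover have "vs e \<noteq> []" using path[of e] e BK by (auto simp: path_in_def)
      then have "{hd (vs e), last (vs e)} \<subseteq> set (vs e)" by simp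
      ultimately have "\<phi> k \<in> set (vs e)" "\<phi> k' \<in> set (vs e)" by simp_all
      then show ?thesis using rtrancl_trans[OF reach_sym[OF along[OF e(1)]] along[OF e(1)]] by blast
    qed
    have lift: "(\<phi> k, \<phi> k') \<in> ?R" if "(k, k') \<in> (adjacency (spanning K ?B))\<^sup>*" for k k'
      using that by (induction rule: rtrancl_induct) (auto intro: rtrancl_trans step)
    have from_branch: "\<exists>k\<in>verts K. (\<phi> k, z) \<in> ?R"
      if d: "d \<in> avoiding C \<mu> c" "z \<in> ends C d" for d z
    proof -
      obtain e where e: "e \<in> ?B" "d \<in> set (es e)" using d(1) av by auto
      have eK: "e \<in> edges K" using e(1) BK by auto
      have "z \<in> set (vs e)" using path_in_ends[OF path[OF eK] e(2)] d(2) by auto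
      moreover have "hd (vs e) \<in> \<phi> ` verts K" using pends[OF eK] multigraphD(3)[OF K(1) eK] by blast
      ultimately show ?thesis using along[OF e(1)] by (elim imageE) metis
    qed
    obtain k k' where k: "k \<in> verts K" "(\<phi> k, x) \<in> ?R" "k' \<in> verts K" "(\<phi> k', y) \<in> ?R"
      using from_branch[OF a] from_branch[OF b] by auto
    have "(\<phi> k, \<phi> k') \<in> ?R" using lift[OF conn[OF c k(1,3)]] .
    then show ?thesis using rtrancl_trans[OF rtrancl_trans[OF reach_sym[OF k(2)]] k(4)] by blast
  qed
  moreover have "\<forall>a\<in>edges C. \<mu> a \<in> {1, 2, 3}" using range lam edges_C by fastforce
  ultimately have "frame_coloring C \<mu>" unfolding frame_coloring_def by blast
  then show ?thesis by blast
qed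

text \<open>
  All conditions are local to a component, so that colorings of the components, chosen
  independently, fit together.
\<close>

lemma frame_coloring_componentwise:
  assumes F: "multigraph F" and "\<And>v. v \<in> verts F \<Longrightarrow> \<exists>\<kappa>. frame_coloring (component_at F v) \<kappa>"
  shows "\<exists>\<kappa>. frame_coloring F \<kappa>"
proof -
  define \<kappa>' where "\<kappa>' D = (SOME \<kappa>. frame_coloring D \<kappa>)" for D :: "('a, 'b) mgraph"
  have col: "frame_coloring (component_at F v) (\<kappa>' (component_at F v))" if "v \<in> verts F" for v
    using assms(2)[OF that] unfolding \<kappa>'_def by (rule someI_ex)
  \<comment> \<open>The component of an edge does not depend on which end is picked.\<close>
  define \<kappa> where "\<kappa> e = \<kappa>' (component_at F (SOME v. v \<in> ends F e)) e" for e
  have \<kappa>: "\<kappa> e = \<kappa>' (component_at F v) e" if e: "e \<in> edges (component_at F v)" for e v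
  proof -
    have eF: "e \<in> edges F" using e by simp
    have "ends F e \<noteq> {}" using multigraphD(4)[OF F eF] by auto
    then have "(SOME v. v \<in> ends F e) \<in> ends F e" by (simp add: some_in_eq)
    then have "(v, SOME v. v \<in> ends F e) \<in> (adjacency F)\<^sup>*" using e by auto
    then show ?thesis using component_at_eq[of v _ F] by (simp add: \<kappa>_def)
  qed
  have av: "avoiding (component_at F v) (\<kappa>' (component_at F v)) c
      = {e \<in> avoiding F \<kappa> c. e \<in> edges (component_at F v)}" for v c
    using \<kappa>[of _ v] unfolding avoiding_def by auto
  have at: "e \<in> edges (component_at F v)" if "e \<in> edges F" "v \<in> ends F e" for e v
    using edge_reach[OF F that] that(1) by simp
  have vF: "v \<in> verts F" if "e \<in> edges F" "v \<in> ends F e" for e v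
    using multigraphD(3)[OF F that(1)] that(2) by auto
  have self: "v \<in> verts (component_at F v)" for v by simp
  have "\<kappa> e \<in> {1, 2, 3}" if e: "e \<in> edges F" for e
  proof -
    obtain v where v: "v \<in> ends F e" using edge_endsE[OF F e] by auto
    show ?thesis using col[OF vF[OF e v]] \<kappa>[OF at[OF e v]] at[OF e v] unfolding frame_coloring_def by metis
  qed
  moreover have "\<exists>e\<in>edges F. x \<in> ends F e" if "x \<in> verts F" for x
  proof -
    have "\<exists>e\<in>edges (component_at F x). x \<in> ends (component_at F x) e"
      using col[OF that] self[of x] unfolding frame_coloring_def by blast
    then show ?thesis by auto
  qed
  moreover have "even (deg_in F (avoiding F \<kappa> c) x)" if "c \<in> {1, 2, 3}" "x \<in> verts F" for c x
  proof -
    have "{e \<in> avoiding F \<kappa> c. x \<in> ends F e}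
      = {e \<in> {e \<in> avoiding F \<kappa> c. e \<in> edges (component_at F x)}. x \<in> ends F e}"
      using at by (auto simp: avoiding_def simp del: component_at_simps)
    then have "deg_in F (avoiding F \<kappa> c) x
        = deg_in (component_at F x) (avoiding (component_at F x) (\<kappa>' (component_at F x)) c) x"
      unfolding av deg_in_def by simp
    then show ?thesis using col[OF that(2)] that(1) self[of x] unfolding frame_coloring_def by metis
  qed
  moreover have "(x, y) \<in> (adjacency (spanning F (avoiding F \<kappa> c)))\<^sup>*"
    if c: "c \<in> {1, 2, 3}" and e: "e \<in> avoiding F \<kappa> c" "x \<in> ends F e"
      and e': "e' \<in> avoiding F \<kappa> c" "y \<in> ends F e'" and xy: "(x, y) \<in> (adjacency F)\<^sup>*" for c e e' x y
  proof -
    let ?D = "component_at F x"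
    let ?B = "avoiding ?D (\<kappa>' ?D) c"
    have eF: "e \<in> edges F" "e' \<in> edges F" using e e' by (auto simp: avoiding_def)
    have "e \<in> ?B" using at[OF eF(1) e(2)] e(1) by (simp add: av)
    moreover have "e' \<in> ?B"
      using at[OF eF(2) e'(2)] e'(1) component_at_eq[OF xy] by (simp add: av)
    moreover have "x \<in> ends ?D e" "y \<in> ends ?D e'" using e e' by auto
    moreover have "(x, y) \<in> (adjacency ?D)\<^sup>*"
      using connected_component_at[of F x] xy by (simp add: connected_graph_def)
    ultimately have "(x, y) \<in> (adjacency (spanning ?D ?B))\<^sup>*"
      using col[OF vF[OF eF(1) e(2)]] c unfolding frame_coloring_def by blast
    moreover have "(adjacency (spanning ?D ?B))\<^sup>* \<subseteq> (adjacency (spanning F (avoiding F \<kappa> c)))\<^sup>*"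
      using av by (intro rtrancl_mono adjacency_mono) auto
    ultimately show ?thesis by blast
  qed
  ultimately have "frame_coloring F \<kappa>" unfolding frame_coloring_def by blast
  then show ?thesis by blast
qed

lemma kotzig_frame_coloring:
  assumes G: "multigraph G" and F: "kotzig_frame G F"
  shows "\<exists>\<kappa>. frame_coloring F \<kappa>"
proof (rule frame_coloring_componentwise)
  show m: "multigraph F" using multigraph_subgraph[OF G] F by (auto simp: kotzig_frame_def)
  fix v assume v: "v \<in> verts F"
  have "multigraph (component_at F v)" using multigraph_subgraph[OF m subgraph_component_at[OF m v]] .
  then show "\<exists>\<kappa>. frame_coloring (component_at F v) \<kappa>"
    using F component_component_at[OF m v] frame_coloring_cycle frame_coloring_subdivision
    unfolding kotzig_frame_def by metis
qed

section \<open>From amiable colorings to even double covers\<close>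

text \<open>
  With \<open>e\<close> outside the frame, \<open>a\<close> and \<open>b\<close> are the only frame edges at \<open>x\<close>. If their colors differed,
  dropping the color of \<open>a\<close> would leave \<open>b\<close> alone at \<open>x\<close>.
\<close>

lemma same_color_at_deg_2_vertex:
  assumes G: "multigraph G" "cubic G" and F: "subgraph F G" "verts F = verts G" "frame_coloring F \<kappa>"
    and e: "e \<in> edges G - edges F" "x \<in> ends G e"
    and a: "a \<in> edges F" "x \<in> ends G a" and b: "b \<in> edges F" "x \<in> ends G b"
  shows "\<kappa> a = \<kappa> b"
proof (rule ccontr)
  assume ne: "\<kappa> a \<noteq> \<kappa> b"
  have x: "x \<in> verts G" using multigraphD(3)[OF G(1)] e by auto
  let ?I = "incident_edges G x"
  have "card ?I = 3" using G(2) x by (simp add: regular_def degree_def)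
  moreover have "{e, a, b} \<subseteq> ?I" using e a b subgraphD(2)[OF F(1)] by (auto simp: incident_edges_def)
  moreover have "e \<noteq> a" "e \<noteq> b" "a \<noteq> b" using e(1) a(1) b(1) ne by auto
  then have "card {e, a, b} = 3" by simp
  moreover have "finite ?I" using multigraphD(2)[OF G(1)] by (simp add: incident_edges_def)
  ultimately have I: "?I = {e, a, b}" using card_subset_eq by metis
  have ends: "ends F = ends G" using subgraphD(3)[OF F(1)] .
  have "{d \<in> avoiding F \<kappa> (\<kappa> a). x \<in> ends F d} = {b}"
  proof (intro equalityI subsetI)
    fix d assume d: "d \<in> {d \<in> avoiding F \<kappa> (\<kappa> a). x \<in> ends F d}"
    then have "d \<in> edges F" "\<kappa> d \<noteq> \<kappa> a" "x \<in> ends G d" by (auto simp: avoiding_def ends)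
    moreover from this have "d \<in> ?I" using subgraphD(2)[OF F(1)] by (auto simp: incident_edges_def)
    ultimately show "d \<in> {b}" using I e(1) by auto
  qed (use b ne in \<open>auto simp: avoiding_def ends\<close>)
  then have "deg_in F (avoiding F \<kappa> (\<kappa> a)) x = 1" by (simp add: deg_in_def)
  moreover have "\<kappa> a \<in> {1, 2, 3}" "x \<in> verts F" using F a x by (auto simp: frame_coloring_def)
  ultimately show False using F(3) unfolding frame_coloring_def by (metis odd_one)
qed

text \<open>
  The classes of \<open>p\<close> are unions of components, and in each of them the colors are permuted by its
  own permutation. Dropping a color afterwards amounts to dropping its preimage before.
\<close>

lemma frame_coloring_permute:
  assumes F: "multigraph F" "frame_coloring F \<kappa>"
    and p: "\<And>a x y. a \<in> edges F \<Longrightarrow> x \<in> ends F a \<Longrightarrow> y \<in> ends F a \<Longrightarrow> p x = p y"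
    and \<pi>: "\<And>x. x \<in> verts F \<Longrightarrow> bij_betw (\<pi> (p x)) {1, 2, 3} {1, 2, 3}"
    and \<mu>: "\<And>a x. a \<in> edges F \<Longrightarrow> x \<in> ends F a \<Longrightarrow> \<mu> a = \<pi> (p x) (\<kappa> a)"
  shows "frame_coloring F \<mu>"
proof -
  have range: "\<kappa> a \<in> {1, 2, 3}" if "a \<in> edges F" for a
    using F(2) that by (auto simp: frame_coloring_def)
  have vF: "x \<in> verts F" if "a \<in> edges F" "x \<in> ends F a" for a x
    using multigraphD(3)[OF F(1) that(1)] that(2) by auto
  have old_color: "\<exists>d\<in>{1, 2, 3}. \<forall>a\<in>edges F. \<forall>y\<in>ends F a. p y = p x \<longrightarrow>
      (a \<in> avoiding F \<mu> c \<longleftrightarrow> a \<in> avoiding F \<kappa> d)" if c: "c \<in> {1, 2, 3}" and x: "x \<in> verts F" for c x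
  proof -
    obtain d where d: "d \<in> {1, 2, 3}" "\<pi> (p x) d = c"
      using bij_betw_imp_surj_on[OF \<pi>[OF x]] c by (metis imageE)
    have "a \<in> avoiding F \<mu> c \<longleftrightarrow> a \<in> avoiding F \<kappa> d"
      if "a \<in> edges F" "y \<in> ends F a" "p y = p x" for a y
      using \<mu>[OF that(1,2)] that d range[OF that(1)] bij_betw_imp_inj_on[OF \<pi>[OF x]]
      unfolding avoiding_def by (auto dest: inj_onD)
    then show ?thesis using d(1) by blast
  qed
  show ?thesis
    unfolding frame_coloring_def
  proof (intro conjI ballI impI)
    show "\<mu> a \<in> {1, 2, 3}" if a: "a \<in> edges F" for a
    proof -
      obtain x where x: "x \<in> ends F a" using edge_endsE[OF F(1) a] by auto
      show ?thesis
        using \<mu>[OF a x] bij_betw_apply[OF \<pi>[OF vF[OF a x]] range[OF a]] by simp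
    qed
    show "\<exists>e\<in>edges F. x \<in> ends F e" if "x \<in> verts F" for x
      using F(2) that by (simp add: frame_coloring_def)
    show "even (deg_in F (avoiding F \<mu> c) x)" if c: "c \<in> {1, 2, 3}" and x: "x \<in> verts F" for c x
    proof -
      obtain d where d: "d \<in> {1, 2, 3}" "\<forall>a\<in>edges F. \<forall>y\<in>ends F a. p y = p x \<longrightarrow>
        (a \<in> avoiding F \<mu> c \<longleftrightarrow> a \<in> avoiding F \<kappa> d)" using old_color[OF c x] by blast
      have "a \<in> avoiding F \<mu> c \<longleftrightarrow> a \<in> avoiding F \<kappa> d" if "x \<in> ends F a" for a
        using d(2) that by (cases "a \<in> edges F") (auto simp: avoiding_def)
      then have "deg_in F (avoiding F \<mu> c) x = deg_in F (avoiding F \<kappa> d) x"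
        unfolding deg_in_def by (intro arg_cong[of _ _ card]) blast
      then show ?thesis using F(2) d(1) x by (simp only: frame_coloring_def)
    qed
    show "(x, y) \<in> (adjacency (spanning F (avoiding F \<mu> c)))\<^sup>*"
      if c: "c \<in> {1, 2, 3}" and a: "a \<in> avoiding F \<mu> c" and b: "b \<in> avoiding F \<mu> c"
        and x: "x \<in> ends F a" and y: "y \<in> ends F b" and xy: "(x, y) \<in> (adjacency F)\<^sup>*" for c a b x y
    proof -
      have ab: "a \<in> edges F" "b \<in> edges F" using a b by (auto simp: avoiding_def)
      obtain d where d: "d \<in> {1, 2, 3}" "\<forall>a\<in>edges F. \<forall>y\<in>ends F a. p y = p x \<longrightarrow>
        (a \<in> avoiding F \<mu> c \<longleftrightarrow> a \<in> avoiding F \<kappa> d)" using old_color[OF c vF[OF ab(1) x]] by blast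
      have "p y = p x" using xy
      proof (induction rule: rtrancl_induct)
        case (step y z)
        then obtain e where "e \<in> edges F" "ends F e = {y, z}" by (auto simp: adjacency_def)
        then show ?case using p[of e y z] step.IH by simp
      qed simp
      then have "a \<in> avoiding F \<kappa> d" "b \<in> avoiding F \<kappa> d" using d(2) a b x y ab by blast+
      then have "(x, y) \<in> (adjacency (spanning F (avoiding F \<kappa> d)))\<^sup>*"
        using F(2) d(1) x y xy unfolding frame_coloring_def by blast
      then have "(x, y) \<in> (adjacency (spanning F (avoiding F \<mu> c)))\<^sup>* \<and> p y = p x"
      proof (induction rule: rtrancl_induct)
        case (step y z)
        then obtain e where e: "e \<in> avoiding F \<kappa> d" "ends F e = {y, z}" by (auto simp: adjacency_def)
        then have eF: "e \<in> edges F" by (auto simp: avoiding_def)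
        have "e \<in> avoiding F \<mu> c" using d(2) eF e step.IH by auto
        then have "(y, z) \<in> adjacency (spanning F (avoiding F \<mu> c))"
          using e(2) by (intro adjacencyI[of e]) auto
        then show ?case using step.IH p[OF eF, of y z] e(2) by auto
      qed simp
      then show ?thesis by blast
    qed
  qed
qed

text \<open>
  Let \<open>T\<close> be the set of vertices where \<open>M c\<close> has odd degree. By \<open>avoid\<close>, the frame edges at these
  vertices belong to \<open>H c\<close>, so \<open>H c\<close> connects those in the same component, of which there are evenly
  many by \<open>even\<close>. Hence \<open>H c\<close> contains a set \<open>J c\<close> having odd degree precisely on \<open>T\<close>.
\<close>

lemma even_double_cover_from_coloring:
  assumes G: "multigraph G" and F: "subgraph F G" "verts F = verts G" "frame_coloring F \<mu>"
    and p: "\<And>x y. x \<in> verts G \<Longrightarrow> y \<in> verts G \<Longrightarrow> p x = p y \<Longrightarrow> (x, y) \<in> (adjacency F)\<^sup>*"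
    and g: "\<And>e. e \<in> edges G - edges F \<Longrightarrow> g e \<in> {1, 2, 3}"
    and avoid: "\<And>e x a. e \<in> edges G - edges F \<Longrightarrow> x \<in> ends G e \<Longrightarrow> a \<in> edges F \<Longrightarrow>
      x \<in> ends G a \<Longrightarrow> \<mu> a \<noteq> g e"
    and even: "\<And>c j. c \<in> {1, 2, 3} \<Longrightarrow>
      even (card {e \<in> boundary G {x \<in> verts G. p x = j}. e \<notin> edges F \<and> g e = c})"
  shows "even_double_cover G"
proof -
  have ends: "ends F = ends G" and EF: "edges F \<subseteq> edges G" using subgraphD[OF F(1)] by auto
  have finE: "finite (edges G)" "finite (verts G)" using multigraphD[OF G] by auto
  define M where "M c = {e \<in> edges G - edges F. g e = c}" for c
  define H where "H c = avoiding F \<mu> c" for c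
  have finMH: "finite (M c)" "finite (H c)" for c
    using finE EF by (auto simp: M_def H_def avoiding_def intro: finite_subset)
  have "\<exists>J. J \<subseteq> H c \<and> (\<forall>x\<in>verts G. odd (deg_in G J x) \<longleftrightarrow> odd (deg_in G (M c) x))"
    if c: "c \<in> {1, 2, 3}" for c
  proof -
    define T where "T = {x \<in> verts G. odd (deg_in G (M c) x)}"
    have "\<exists>J\<subseteq>H c. \<forall>x. odd (deg_in G J x) \<longleftrightarrow> x \<in> T"
    proof (rule t_join[where p = p])
      fix e assume "e \<in> H c"
      then have "e \<in> edges G" using EF by (auto simp: H_def avoiding_def)
      then show "card (ends G e) = 2" by (rule multigraphD(4)[OF G])
    next
      fix j
      let ?X = "{x \<in> verts G. p x = j}"
      have "{e \<in> M c. ends G e \<inter> ?X \<noteq> {} \<and> ends G e - ?X \<noteq> {}} =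
          {e \<in> boundary G ?X. e \<notin> edges F \<and> g e = c}" by (auto simp: boundary_def M_def)
      moreover have "e \<in> M c \<Longrightarrow> card (ends G e) = 2" for e
        using multigraphD(4)[OF G] by (simp add: M_def)
      ultimately have "even (\<Sum>x\<in>?X. deg_in G (M c) x)"
        using handshake[of "M c" ?X G] finMH(1) finE(2) even[OF c, of j] by simp
      moreover have "finite ?X" using finE(2) by simp
      ultimately have "even (card {x \<in> ?X. odd (deg_in G (M c) x)})" using even_sum_iff by blast
      moreover have "{x \<in> ?X. odd (deg_in G (M c) x)} = {x \<in> T. p x = j}" by (auto simp: T_def)
      ultimately show "even (card {x \<in> T. p x = j})" by simp
    next
      fix x y assume xy: "x \<in> T" "y \<in> T" "p x = p y"
      have on_H: "\<exists>a\<in>H c. z \<in> ends F a" if z: "z \<in> T" for z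
      proof -
        have "{e \<in> M c. z \<in> ends G e} \<noteq> {}"
          using z unfolding T_def deg_in_def by (metis (no_types, lifting) card.empty even_zero mem_Collect_eq)
        then obtain e where e: "e \<in> M c" "z \<in> ends G e" by auto
        obtain a where a: "a \<in> edges F" "z \<in> ends F a"
          using F(2,3) z unfolding frame_coloring_def T_def by blast
        have "\<mu> a \<noteq> c" using avoid[of e z a] e a by (auto simp: M_def ends)
        then show ?thesis using a by (auto simp: H_def avoiding_def)
      qed
      have "(x, y) \<in> (adjacency F)\<^sup>*" using p xy by (auto simp: T_def)
      then have "(x, y) \<in> (adjacency (spanning F (H c)))\<^sup>*"
        using on_H[OF xy(1)] on_H[OF xy(2)] F(3) c unfolding frame_coloring_def H_def by blast
      moreover have "adjacency (spanning F (H c)) = adjacency (spanning G (H c))"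
        by (simp add: adjacency_def ends)
      ultimately show "(x, y) \<in> (adjacency (spanning G (H c)))\<^sup>*" by simp
    qed (use finMH finE in \<open>auto simp: T_def\<close>)
    then show ?thesis by (auto simp: T_def)
  qed
  then obtain J where J: "\<And>c. c \<in> {1, 2, 3} \<Longrightarrow> J c \<subseteq> H c"
    and J_odd: "\<And>c x. c \<in> {1, 2, 3} \<Longrightarrow> x \<in> verts G \<Longrightarrow> odd (deg_in G (J c) x) \<longleftrightarrow> odd (deg_in G (M c) x)"
    by metis
  define A where "A = (\<lambda>(c, b). if b then M c \<union> J c else M c \<union> (H c - J c))"
  have evA: "even_set G (A (c, b))" if c: "c \<in> {1, 2, 3}" for c b
  proof -
    have fin: "finite (J c)" "finite (M c)" using finite_subset[OF J[OF c] finMH(2)] finMH(1) by simp_all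
    have disj: "M c \<inter> H c = {}" by (auto simp: M_def H_def avoiding_def)
    have "even_set G (M c \<union> J c)"
      unfolding even_set_def
    proof (intro conjI ballI)
      show "M c \<union> J c \<subseteq> edges G" using J[OF c] EF by (auto simp: M_def H_def avoiding_def)
      fix x assume "x \<in> verts G"
      moreover have "M c \<inter> J c = {}" using disj J[OF c] by auto
      ultimately show "even (deg_in G (M c \<union> J c) x)"
        using J_odd[OF c, of x] deg_in_Un[OF fin(2,1), of G x] by simp
    qed
    moreover have "even_set G (H c)"
      using F(2,3) c EF unfolding even_set_def frame_coloring_def H_def
      by (auto simp: avoiding_def deg_in_def ends)
    ultimately have "even_set G (sym_diff (M c \<union> J c) (H c))" "even_set G (M c \<union> J c)"
      using even_set_sym_diff[OF finE(1)] by auto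
    moreover have "sym_diff (M c \<union> J c) (H c) = M c \<union> (H c - J c)" using disj J[OF c] by auto
    ultimately show ?thesis by (simp add: A_def)
  qed
  show ?thesis
  proof (rule even_double_coverI[of "{1, 2, 3 :: nat} \<times> (UNIV :: bool set)" G A])
    fix e assume e: "e \<in> edges G"
    have mem: "e \<in> A (c, b) \<longleftrightarrow> (if e \<in> edges F then c \<noteq> \<mu> e \<and> b = (e \<in> J c) else c = g e)"
      if "c \<in> {1, 2, 3}" for c b
    proof -
      have "e \<in> J c \<Longrightarrow> e \<in> edges F \<and> \<mu> e \<noteq> c" using J[OF that] by (auto simp: H_def avoiding_def)
      then show ?thesis using e by (cases b) (auto simp: A_def M_def H_def avoiding_def)
    qed
    show "card {i \<in> {1, 2, 3} \<times> UNIV. e \<in> A i} = 2"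
    proof (cases "e \<in> edges F")
      case False
      then have "{i \<in> {1, 2, 3} \<times> UNIV. e \<in> A i} = {(g e, True), (g e, False)}"
        using e g[of e] mem by auto
      then show ?thesis by simp
    next
      case True
      then have \<mu>: "\<mu> e \<in> {1, 2, 3}" using F(3) by (simp add: frame_coloring_def)
      have "{i \<in> {1, 2, 3} \<times> UNIV. e \<in> A i} = (\<lambda>c. (c, e \<in> J c)) ` ({1, 2, 3} - {\<mu> e})"
        using True mem by (auto simp: image_iff)
      moreover have "inj_on (\<lambda>c. (c, e \<in> J c)) ({1, 2, 3} - {\<mu> e})" by (auto simp: inj_on_def)
      moreover have "card ({1, 2, 3} - {\<mu> e}) = 2" using \<mu> by auto
      ultimately show ?thesis by (simp add: card_image)
    qed
  qed (use evA in auto)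
qed

lemma even_boundary_if_even_card:
  assumes G: "multigraph G" "cubic G" and X: "X \<subseteq> verts G" "even (card X)"
  shows "even (card (boundary G X))"
proof -
  have fin: "finite X" using X(1) multigraphD(1)[OF G(1)] finite_subset by blast
  have "(\<Sum>v\<in>X. deg_in G (edges G) v) = 3 * card X"
    using G(2) X(1) by (simp add: regular_def degree_eq subset_eq)
  then show ?thesis
    using handshake[of "edges G" X G] multigraphD[OF G(1)] fin X(2) by (simp add: boundary_def)
qed

text \<open>
  The 3-row graph has a column for each component of \<open>F\<close>. An edge joining two components is attached,
  in either column, to the row numbered by the color of the frame edges at its end. A component has
  evenly many vertices, hence evenly many edges leave it, so the columns have even degree. Edges
  outside \<open>F\<close> with both ends in one component are not part of the 3-row graph. For them at most two
  colors are forbidden, and they contribute twice to the parity of their component, so any color left will do.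
\<close>

theorem even_double_cover_if_kotzig_frame:
  fixes G :: "('v, 'e) mgraph"
  assumes amiable: "\<And>s (R :: (nat \<times> nat, 'e) mgraph). three_row_graph s R \<Longrightarrow>
      eulerian (column_graph R) \<Longrightarrow> \<exists>f g. amiable_coloring s R f g"
    and G: "multigraph G" "cubic G" and frame: "kotzig_frame G F"
  shows "even_double_cover G"
proof -
  have F: "subgraph F G" "verts F = verts G" using frame by (auto simp: kotzig_frame_def)
  have mF: "multigraph F" using multigraph_subgraph[OF G(1) F(1)] .
  have ends: "ends F = ends G" and EF: "edges F \<subseteq> edges G" using subgraphD[OF F(1)] by auto
  have finV: "finite (verts G)" and finE: "finite (edges G)" using multigraphD[OF G(1)] by auto
  obtain \<kappa> where \<kappa>: "frame_coloring F \<kappa>" using kotzig_frame_coloring[OF G(1) frame] by auto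
  have range_\<kappa>: "\<kappa> a \<in> {1, 2, 3}" if "a \<in> edges F" for a
    using \<kappa> that by (simp add: frame_coloring_def)
  define s where "s = card (component_at F ` verts G)"
  obtain h where h: "bij_betw h {1..s} (component_at F ` verts G)"
    using ex_bij_betw_nat_finite_1[of "component_at F ` verts G"] finV unfolding s_def by auto
  \<comment> \<open>\<open>p v\<close> is the column of the component of \<open>v\<close>.\<close>
  define p where "p v = inv_into {1..s} h (component_at F v)" for v
  have hp: "h (p v) = component_at F v" and p_range: "p v \<in> {1..s}" if "v \<in> verts G" for v
    using that bij_betw_imp_surj_on[OF h] unfolding p_def
    by (metis f_inv_into_f imageI, metis imageI inv_into_into)
  have p_reach: "(x, y) \<in> (adjacency F)\<^sup>*" if "x \<in> verts G" "y \<in> verts G" "p x = p y" for x y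
  proof -
    have "component_at F x = component_at F y" using hp that by metis
    then have "verts (component_at F x) = verts (component_at F y)" by simp
    then show ?thesis by auto
  qed
  have p_edge: "p x = p y" if "a \<in> edges F" "x \<in> ends F a" "y \<in> ends F a" for a x y
  proof -
    have "(x, y) \<in> (adjacency F)\<^sup>*" using edge_reach[OF mF that(1,2)] that(3) by auto
    then show ?thesis using component_at_eq unfolding p_def by metis
  qed
  define V where "V j = {x \<in> verts G. p x = j}" for j
  have even_V: "even (card (V j))" if j: "j \<in> {1..s}" for j
  proof -
    obtain v where v: "v \<in> verts G" "h j = component_at F v"
      using bij_betw_apply[OF h j] by auto
    have pv: "p v = j"
      unfolding p_def v(2)[symmetric] by (rule inv_into_f_f[OF bij_betw_imp_inj_on[OF h] j])
    have "V j = verts (component_at F v)"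
    proof (intro equalityI subsetI)
      fix x assume "x \<in> V j"
      then show "x \<in> verts (component_at F v)" using p_reach[OF v(1), of x] pv by (simp add: V_def)
    next
      fix x assume "x \<in> verts (component_at F v)"
      then have vx: "(v, x) \<in> (adjacency F)\<^sup>*" by simp
      then have "x \<in> verts G" using reach_in_verts[OF mF] v(1) F(2) by metis
      moreover have "p x = j" using component_at_eq[OF vx] pv by (simp add: p_def)
      ultimately show "x \<in> V j" by (simp add: V_def)
    qed
    moreover have "even (card (verts (component_at F v)))"
      using frame component_component_at[OF mF, of v] v(1) F(2) unfolding kotzig_frame_def by blast
    ultimately show ?thesis by simp
  qed
  define N where "N = {e \<in> edges G - edges F. \<exists>x\<in>ends G e. \<exists>y\<in>ends G e. p x \<noteq> p y}"
  have vG: "x \<in> verts G" if "e \<in> edges G" "x \<in> ends G e" for e x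
    using multigraphD(3)[OF G(1) that(1)] that(2) by auto
  have boundary_V: "boundary G (V j) = {e \<in> N. j \<in> p ` ends G e}" for j
  proof (intro equalityI subsetI)
    fix e assume "e \<in> boundary G (V j)"
    then obtain x y where e: "e \<in> edges G" "x \<in> ends G e" "x \<in> V j" "y \<in> ends G e" "y \<notin> V j"
      by (auto simp: boundary_def)
    then have "p x = j" "p y \<noteq> j" using vG by (auto simp: V_def)
    moreover from this have "e \<notin> edges F" using p_edge[of e x y] e by (auto simp: ends)
    ultimately show "e \<in> {e \<in> N. j \<in> p ` ends G e}" using e by (auto simp: N_def)
  next
    fix e assume "e \<in> {e \<in> N. j \<in> p ` ends G e}"
    then obtain x y z where e: "e \<in> edges G" "x \<in> ends G e" "y \<in> ends G e" "p x \<noteq> p y" "z \<in> ends G e" "p z = j"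
      by (auto simp: N_def)
    have "\<exists>u\<in>ends G e. p u \<noteq> j" using e by metis
    then show "e \<in> boundary G (V j)" using e vG[OF e(1)] by (auto simp: boundary_def V_def)
  qed
  \<comment> \<open>At a vertex of degree 3 in \<open>F\<close> the row is that of an arbitrary edge; this is harmless, as no edge
    outside \<open>F\<close> ends there.\<close>
  define r where "r x = \<kappa> (SOME a. a \<in> edges F \<and> x \<in> ends F a)" for x
  have some_edge: "(SOME a. a \<in> edges F \<and> x \<in> ends F a) \<in> edges F"
    "x \<in> ends F (SOME a. a \<in> edges F \<and> x \<in> ends F a)" if "x \<in> verts G" for x
  proof -
    have "\<exists>a. a \<in> edges F \<and> x \<in> ends F a"
      using \<kappa> that F(2) unfolding frame_coloring_def by blast
    from someI_ex[OF this] show "(SOME a. a \<in> edges F \<and> x \<in> ends F a) \<in> edges F"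
      "x \<in> ends F (SOME a. a \<in> edges F \<and> x \<in> ends F a)" by blast+
  qed
  have r_eq: "r x = \<kappa> a"
    if "e \<in> edges G - edges F" "x \<in> ends G e" "a \<in> edges F" "x \<in> ends G a" for e x a
    using same_color_at_deg_2_vertex[OF G F \<kappa> that(1,2) _ _ that(3,4)] some_edge[of x] vG that
    unfolding r_def ends by blast
  have r_range: "r x \<in> {1, 2, 3}" if "x \<in> verts G" for x
    using range_\<kappa> some_edge[OF that] unfolding r_def by blast
  define q where "q x = (r x, p x)" for x
  define R where "R = \<lparr>verts = {1..3} \<times> {1..s}, edges = N, ends = (\<lambda>e. q ` ends G e)\<rparr>"
  have R_simps: "verts R = {1..3} \<times> {1..s}" "edges R = N" "ends R e = q ` ends G e" for e
    by (simp_all add: R_def)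
  have q_verts: "q x \<in> verts R" if "x \<in> verts G" for x
    using r_range[OF that] p_range[OF that] by (auto simp: q_def R_simps)
  have NE: "N \<subseteq> edges G - edges F" by (auto simp: N_def)
  have two_ends: "\<exists>x y. ends G e = {x, y} \<and> p x \<noteq> p y \<and> x \<in> verts G \<and> y \<in> verts G" if e: "e \<in> N" for e
  proof -
    have eG: "e \<in> edges G" using e NE by auto
    obtain x y where xy: "ends G e = {x, y}" "x \<in> verts G" "y \<in> verts G"
      by (rule edge_endsE[OF G(1) eG])
    have "p x \<noteq> p y"
    proof
      assume "p x = p y"
      then show False using e xy(1) by (simp add: N_def)
    qed
    then show ?thesis using xy by blast
  qed
  have three_row: "three_row_graph s R"
    unfolding three_row_graph_def multigraph_def
  proof (intro conjI ballI)
    show "finite (verts R)" by (simp add: R_simps)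
    show "finite (edges R)" using finE NE finite_subset by (auto simp: R_simps)
    show "verts R = {1..3} \<times> {1..s}" by (simp add: R_simps)
  next
    fix e assume "e \<in> edges R"
    then obtain x y where xy: "ends G e = {x, y}" "p x \<noteq> p y" "x \<in> verts G" "y \<in> verts G"
      using two_ends[of e] unfolding R_simps by blast
    show "ends R e \<subseteq> verts R" using xy q_verts by (simp add: R_simps(3))
    show "card (ends R e) = 2" using xy by (simp add: R_simps q_def)
    show "\<not> ends R e \<subseteq> column j" for j using xy by (auto simp: R_simps q_def column_def)
  qed
  have "eulerian (column_graph R)"
    unfolding eulerian_def
  proof
    fix j assume "j \<in> verts (column_graph R)"
    then have j: "j \<in> {1..s}" by (auto simp: column_graph_def identify_def R_simps)
    have "incident_edges (column_graph R) j = boundary G (V j)"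
      unfolding boundary_V
      by (auto simp: incident_edges_def column_graph_def identify_def R_simps q_def image_image)
    then show "even (degree (column_graph R) j)"
      using even_boundary_if_even_card[OF G _ even_V[OF j]] by (auto simp: degree_def V_def)
  qed
  then obtain f g where fg: "amiable_coloring s R f g" using amiable[OF three_row] by auto
  have f_range: "f v \<in> {1, 2, 3}" if "v \<in> verts R" for v
    using fg that by (simp add: amiable_coloring_def vertex_3_coloring_def)
  have g_range: "g e \<in> {1, 2, 3}" if "e \<in> N" for e
    using fg that by (simp add: amiable_coloring_def edge_3_coloring_def R_simps)
  have f_inj: "f v \<noteq> f w" if "j \<in> {1..s}" "v \<in> column j" "w \<in> column j" "v \<noteq> w" for v w j
    using fg that unfolding amiable_coloring_def by blast
  have f_g: "f v \<noteq> g e" if "v \<in> verts R" "e \<in> incident_edges R v" for v e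
    using fg that unfolding amiable_coloring_def by blast
  have g_even: "even (color_degree R g c (1, j) + color_degree R g c (2, j) + color_degree R g c (3, j))"
    if "c \<in> {1, 2, 3}" "j \<in> {1..s}" for c j
    using fg that unfolding amiable_coloring_def by blast
  have perm: "bij_betw (\<lambda>i. f (i, j)) {1, 2, 3} {1, 2, 3}" if j: "j \<in> {1..s}" for j
  proof -
    have "inj_on (\<lambda>i. f (i, j)) {1, 2, 3}"
    proof (rule inj_onI, rule ccontr)
      fix i i' :: nat assume "i \<in> {1, 2, 3}" "i' \<in> {1, 2, 3}" "f (i, j) = f (i', j)" "i \<noteq> i'"
      then show False using f_inj[OF j, of "(i, j)" "(i', j)"] by (auto simp: column_def)
    qed
    moreover have "f (i, j) \<in> {1, 2, 3}" if "i \<in> {1, 2, 3}" for i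
      using f_range[of "(i, j)"] that j by (auto simp: R_simps)
    then have "(\<lambda>i. f (i, j)) ` {1, 2, 3} \<subseteq> {1, 2, 3}" by blast
    moreover have "finite {1, 2, 3 :: nat}" by simp
    ultimately show ?thesis unfolding bij_betw_def using endo_inj_surj by blast
  qed
  \<comment> \<open>In column \<open>j\<close> the vertex coloring of the 3-row graph permutes the frame colors by
    \<open>i \<mapsto> f (i, j)\<close>.\<close>
  define \<mu> where "\<mu> a = f (\<kappa> a, p (SOME x. x \<in> ends F a))" for a
  have \<mu>: "\<mu> a = f (\<kappa> a, p x)" if a: "a \<in> edges F" "x \<in> ends F a" for a x
  proof -
    have "(SOME x. x \<in> ends F a) \<in> ends F a" using a(2) by (rule someI)
    then show ?thesis using p_edge[OF a(1)] a(2) unfolding \<mu>_def by metis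
  qed
  have frame_\<mu>: "frame_coloring F \<mu>"
  proof (rule frame_coloring_permute[where p = p and \<pi> = "\<lambda>j i. f (i, j)", OF mF \<kappa>])
    show "p x = p y" if "a \<in> edges F" "x \<in> ends F a" "y \<in> ends F a" for a x y
      using p_edge[OF that] .
    show "bij_betw (\<lambda>i. f (i, p x)) {1, 2, 3} {1, 2, 3}" if "x \<in> verts F" for x
      using perm p_range that F(2) by simp
    show "\<mu> a = f (\<kappa> a, p x)" if "a \<in> edges F" "x \<in> ends F a" for a x
      using \<mu>[OF that] .
  qed
  have "\<exists>c. c \<in> {1, 2, 3} \<and> c \<notin> f ` q ` ends G e \<and> (e \<in> N \<longrightarrow> c = g e)"
    if e: "e \<in> edges G - edges F" for e
  proof (cases "e \<in> N")
    case True
    have "g e \<noteq> f (q x)" if "x \<in> ends G e" for x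
      using f_g[of "q x" e] q_verts[of x] vG[of e x] e that True
      by (auto simp: incident_edges_def R_simps)
    then show ?thesis using g_range[OF True] by auto
  next
    case False
    obtain x y where "ends G e = {x, y}" using e by (elim DiffE edge_endsE[OF G(1)])
    then have "card (f ` q ` ends G e) \<le> 2" by (auto simp: card_insert_if)
    then have "card (f ` q ` ends G e) < card {1, 2, 3 :: nat}" by simp
    moreover have "finite (f ` q ` ends G e)" using \<open>ends G e = {x, y}\<close> by simp
    ultimately have "\<not> {1, 2, 3} \<subseteq> f ` q ` ends G e" using card_mono leD by blast
    then show ?thesis using False by blast
  qed
  then obtain g' where g': "\<And>e. e \<in> edges G - edges F \<Longrightarrow> g' e \<in> {1, 2, 3}"
    "\<And>e. e \<in> edges G - edges F \<Longrightarrow> g' e \<notin> f ` q ` ends G e"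
    "\<And>e. e \<in> N \<Longrightarrow> g' e = g e" using NE by (metis subsetD)
  show ?thesis
  proof (rule even_double_cover_from_coloring[OF G(1) F frame_\<mu> p_reach g'(1)])
    fix e x a assume e: "e \<in> edges G - edges F" "x \<in> ends G e" "a \<in> edges F" "x \<in> ends G a"
    have "\<mu> a = f (q x)" using \<mu>[of a x] r_eq[OF e] e by (simp add: ends q_def)
    moreover have "f (q x) \<in> f ` q ` ends G e" using e(2) by blast
    ultimately show "\<mu> a \<noteq> g' e" using g'(2)[OF e(1)] by metis
  next
    fix c :: nat and j assume c: "c \<in> {1, 2, 3}"
    have "even (card {e \<in> boundary G (V j). e \<notin> edges F \<and> g' e = c})"
    proof (cases "j \<in> {1..s}")
      case False
      then have "V j = {}" using p_range by (auto simp: V_def)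
      then show ?thesis by (simp add: boundary_def)
    next
      case True
      define D where "D i = {e \<in> N. (i, j) \<in> q ` ends G e \<and> g e = c}" for i
      have "{e \<in> boundary G (V j). e \<notin> edges F \<and> g' e = c} = D 1 \<union> D 2 \<union> D 3"
      proof (intro equalityI subsetI)
        fix e assume "e \<in> {e \<in> boundary G (V j). e \<notin> edges F \<and> g' e = c}"
        then have e: "e \<in> N" "j \<in> p ` ends G e" "g e = c" using g'(3) by (auto simp: boundary_V)
        then obtain x where x: "x \<in> ends G e" "p x = j" by auto
        have "r x \<in> {1, 2, 3}" using r_range vG x(1) e(1) NE by blast
        moreover have "e \<in> D (r x)" using e x by (auto simp: D_def q_def)
        ultimately show "e \<in> D 1 \<union> D 2 \<union> D 3" by auto
      next
        fix e assume "e \<in> D 1 \<union> D 2 \<union> D 3"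
        then show "e \<in> {e \<in> boundary G (V j). e \<notin> edges F \<and> g' e = c}"
          using g'(3) NE by (auto simp: boundary_V D_def q_def)
      qed
      moreover have disj: "D i \<inter> D i' = {}" if "i \<noteq> i'" for i i'
      proof -
        have False if "e \<in> D i" "e \<in> D i'" for e
        proof -
          obtain x y where "ends G e = {x, y}" "p x \<noteq> p y" using two_ends[of e] \<open>e \<in> D i\<close> unfolding D_def by blast
          then show False using that \<open>i \<noteq> i'\<close> by (auto simp: D_def q_def)
        qed
        then show ?thesis by blast
      qed
      moreover have fin: "finite (D i)" for i
        using finite_subset[of "D i" "edges G"] finE NE by (auto simp: D_def)
      moreover have "card (D 1 \<union> D 2 \<union> D 3) = card (D 1) + card (D 2) + card (D 3)"
        using disj[of 1 2] disj[of 1 3] disj[of 2 3] fin by (simp add: card_Un_disjoint Int_Un_distrib2)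
      moreover have "card (D i) = color_degree R g c (i, j)" for i
        unfolding color_degree_def incident_edges_def D_def R_simps by (intro arg_cong[of _ _ card]) auto
      ultimately show ?thesis using g_even[OF c True] by simp
    qed
    then show "even (card {e \<in> boundary G {x \<in> verts G. p x = j}. e \<notin> edges F \<and> g' e = c})"
      by (simp add: V_def)
  qed
qed

section \<open>Renaming vertices and edges\<close>

definition relabel :: "('v \<Rightarrow> 'w) \<Rightarrow> ('e \<Rightarrow> 'f) \<Rightarrow> ('v, 'e) mgraph \<Rightarrow> ('w, 'f) mgraph" where
  "relabel \<alpha> \<beta> G = \<lparr>verts = \<alpha> ` verts G, edges = \<beta> ` edges G,
     ends = (\<lambda>e. \<alpha> ` ends G (inv_into (edges G) \<beta> e))\<rparr>"

lemma relabel_simps [simp]: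
  "verts (relabel \<alpha> \<beta> G) = \<alpha> ` verts G" "edges (relabel \<alpha> \<beta> G) = \<beta> ` edges G"
  by (simp_all add: relabel_def)

lemma ends_relabel:
  "inj_on \<beta> (edges G) \<Longrightarrow> e \<in> edges G \<Longrightarrow> ends (relabel \<alpha> \<beta> G) (\<beta> e) = \<alpha> ` ends G e"
  by (simp add: relabel_def)

lemma multigraph_relabel:
  assumes "multigraph G" "inj_on \<alpha> (verts G)" "inj_on \<beta> (edges G)"
  shows "multigraph (relabel \<alpha> \<beta> G)"
  unfolding multigraph_def
proof (intro conjI ballI)
  fix e' assume "e' \<in> edges (relabel \<alpha> \<beta> G)"
  then obtain e where e: "e \<in> edges G" "e' = \<beta> e" by auto
  have *: "ends (relabel \<alpha> \<beta> G) e' = \<alpha> ` ends G e" using ends_relabel[OF assms(3) e(1), of \<alpha>] e(2) by simp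
  show "ends (relabel \<alpha> \<beta> G) e' \<subseteq> verts (relabel \<alpha> \<beta> G)"
    unfolding * using multigraphD(3)[OF assms(1) e(1)] by auto
  show "card (ends (relabel \<alpha> \<beta> G) e') = 2"
    unfolding * using multigraphD(3,4)[OF assms(1) e(1)] assms(2) by (metis card_image inj_on_subset)
qed (use multigraphD[OF assms(1)] in auto)

lemma deg_in_relabel:
  assumes G: "multigraph G" and inj: "inj_on \<alpha> (verts G)" "inj_on \<beta> (edges G)"
    and A: "A \<subseteq> edges G" and v: "v \<in> verts G"
  shows "deg_in (relabel \<alpha> \<beta> G) (\<beta> ` A) (\<alpha> v) = deg_in G A v"
proof -
  have iff: "\<alpha> v \<in> ends (relabel \<alpha> \<beta> G) (\<beta> e) \<longleftrightarrow> v \<in> ends G e" if "e \<in> A" for e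
  proof -
    have e: "e \<in> edges G" using that A by auto
    show ?thesis
      using inj_on_image_mem_iff[OF inj(1) v multigraphD(3)[OF G e]] ends_relabel[OF inj(2) e, of \<alpha>] by simp
  qed
  have "{e' \<in> \<beta> ` A. \<alpha> v \<in> ends (relabel \<alpha> \<beta> G) e'} = \<beta> ` {e \<in> A. v \<in> ends G e}"
    using iff by blast
  moreover have "inj_on \<beta> {e \<in> A. v \<in> ends G e}" using inj(2) A by (blast intro: inj_on_subset)
  ultimately show ?thesis unfolding deg_in_def by (metis card_image)
qed

lemma cubic_relabel:
  assumes "multigraph G" "inj_on \<alpha> (verts G)" "inj_on \<beta> (edges G)" "cubic G"
  shows "cubic (relabel \<alpha> \<beta> G)"
  using deg_in_relabel[OF assms(1-3) order_refl] assms(4) by (simp add: regular_def degree_eq)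

lemma two_edge_connected_relabel:
  assumes G: "multigraph G" and inj: "inj_on \<alpha> (verts G)" "inj_on \<beta> (edges G)"
    and "two_edge_connected G"
  shows "two_edge_connected (relabel \<alpha> \<beta> G)"
  unfolding two_edge_connected_def
proof (intro allI impI)
  fix Z assume Z: "Z \<subseteq> verts (relabel \<alpha> \<beta> G) \<and> Z \<noteq> {} \<and> Z \<noteq> verts (relabel \<alpha> \<beta> G)"
  define X where "X = {v \<in> verts G. \<alpha> v \<in> Z}"
  have ZX: "Z = \<alpha> ` X" using Z by (auto simp: X_def)
  have "X \<subseteq> verts G" by (auto simp: X_def)
  moreover have "X \<noteq> {}" "X \<noteq> verts G" using Z unfolding ZX relabel_simps by blast+
  ultimately have "2 \<le> card (boundary G X)" using assms(4) by (simp add: two_edge_connected_def)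
  also have "card (boundary G X) = card (\<beta> ` boundary G X)"
    using inj_on_subset[OF inj(2), of "boundary G X"] by (simp add: card_image boundary_def)
  finally have "2 \<le> card (\<beta> ` boundary G X)" .
  moreover have "\<beta> ` boundary G X \<subseteq> boundary (relabel \<alpha> \<beta> G) Z"
  proof
    fix e' assume "e' \<in> \<beta> ` boundary G X"
    then obtain e where e: "e \<in> boundary G X" "e' = \<beta> e" by auto
    then have eG: "e \<in> edges G" by (simp add: boundary_def)
    obtain u v where uv: "u \<in> ends G e" "u \<in> X" "v \<in> ends G e" "v \<notin> X" using e(1) by (auto simp: boundary_def)
    have "\<alpha> u \<in> Z" "\<alpha> v \<notin> Z" using uv multigraphD(3)[OF G eG] by (auto simp: X_def)
    moreover have "ends (relabel \<alpha> \<beta> G) e' = \<alpha> ` ends G e" using ends_relabel[OF inj(2) eG, of \<alpha>] e(2) by simp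
    ultimately show "e' \<in> boundary (relabel \<alpha> \<beta> G) Z" using uv eG e(2) by (auto simp: boundary_def)
  qed
  then have "card (\<beta> ` boundary G X) \<le> card (boundary (relabel \<alpha> \<beta> G) Z)"
    using finite_boundary[OF multigraph_relabel[OF G inj]] card_mono by blast
  ultimately show "2 \<le> card (boundary (relabel \<alpha> \<beta> G) Z)" by simp
qed

lemma even_double_cover_relabel:
  assumes G: "multigraph G" and inj: "inj_on \<alpha> (verts G)" "inj_on \<beta> (edges G)"
    and "even_double_cover (relabel \<alpha> \<beta> G)"
  shows "even_double_cover G"
proof -
  obtain I :: "nat set" and A where I: "finite I"
    and A: "\<And>i. i \<in> I \<Longrightarrow> even_set (relabel \<alpha> \<beta> G) (A i)"
    and two: "\<And>e. e \<in> edges (relabel \<alpha> \<beta> G) \<Longrightarrow> card {i \<in> I. e \<in> A i} = 2"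
    using assms(4) unfolding even_double_cover_def by blast
  define B where "B i = {e \<in> edges G. \<beta> e \<in> A i}" for i
  show ?thesis
  proof (rule even_double_coverI[OF I])
    fix i assume i: "i \<in> I"
    have B: "B i \<subseteq> edges G" by (auto simp: B_def)
    have "A i = \<beta> ` B i" using A[OF i] by (auto simp: B_def even_set_def)
    then show "even_set G (B i)"
      using A[OF i] deg_in_relabel[OF G inj B] B by (simp add: even_set_def)
  next
    fix e assume "e \<in> edges G"
    then show "card {i \<in> I. e \<in> B i} = 2" using two[of "\<beta> e"] by (simp add: B_def)
  qed
qed

theorem corollary11:
  fixes G :: "('v, 'e) mgraph"
  assumes "\<forall>(s :: nat) (R :: (nat \<times> nat, nat) mgraph).
             three_row_graph s R \<and> eulerian (column_graph R) \<longrightarrow> (\<exists>f g. amiable_coloring s R f g)"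
    and "\<forall>H :: (nat, nat) mgraph.
             multigraph H \<and> cubic H \<and> cyclically_edge_connected 4 H \<longrightarrow> (\<exists>F. kotzig_frame H F)"
    and "multigraph G" and "cubic G" and "two_connected G"
  shows "\<exists>S. cycle_double_cover G S"
proof -
  \<comment> \<open>The hypotheses speak of graphs on natural numbers; every finite graph has an isomorphic copy there.\<close>
  obtain \<alpha> :: "'v \<Rightarrow> nat" where \<alpha>: "inj_on \<alpha> (verts G)"
    using finite_imp_inj_to_nat_seg multigraphD(1)[OF assms(3)] by blast
  obtain \<beta> :: "'e \<Rightarrow> nat" where \<beta>: "inj_on \<beta> (edges G)"
    using finite_imp_inj_to_nat_seg multigraphD(2)[OF assms(3)] by blast
  let ?H = "relabel \<alpha> \<beta> G"
  have "even_double_cover ?H"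
  proof (rule even_double_cover_if_cyclically_4_edge_connected)
    fix H :: "(nat, nat) mgraph"
    assume H: "multigraph H" "cubic H" "cyclically_edge_connected 4 H"
    then obtain F where "kotzig_frame H F" using assms(2) by blast
    then show "even_double_cover H"
      using even_double_cover_if_kotzig_frame[OF _ H(1,2)] assms(1) by blast
  next
    show "multigraph ?H" by (rule multigraph_relabel[OF assms(3) \<alpha> \<beta>])
    show "cubic ?H" by (rule cubic_relabel[OF assms(3) \<alpha> \<beta> assms(4)])
    show "two_edge_connected ?H"
      using two_edge_connected_relabel[OF assms(3) \<alpha> \<beta>]
        two_edge_connected_if_two_connected[OF assms(3-5)] by blast
    show "verts ?H \<noteq> {}" using assms(5) by (auto simp: two_connected_def)
  qed
  then have "even_double_cover G" by (rule even_double_cover_relabel[OF assms(3) \<alpha> \<beta>])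
  then show ?thesis by (rule cycle_double_cover_if_even_double_cover[OF assms(3,4)])
qed

end
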